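(* Let $H,K,U$, $A,B,R,Q,Q_T,\overline Q,\overline Q_T,S,S_T,\sigma$ and $T>0$ be as in the context. Let $P\in C_s([0,T];\Sigma^+(H))$ be the unique mild solution of the backward Riccati equation $$P'(t)+P(t)A+A^*P(t)-P(t)BR^{-1}B^*P(t)+Q+\overline Q=0,\qquad P(T)=Q_T+\overline Q_T,$$ and let $A_n=n^2R(n,A)-nI$ be the Yosida approximations of $A$. Then there exists $\tau>0$ (with $\tau\le T$, and not depending on $n$) such that, for every $n$, there exists a unique strict solution $\eta_n\in C^1_s([0,\tau];\Sigma(H))$ on the interval $[0,\tau]$ of the forward Riccati equation $$\eta_n'(t)=(-P(T-t)BR^{-1}B^*+A_n^* )\eta_n(t)+\eta_n(t)(A_n-BR^{-1}B^*P(T-t))-\overline QS-\eta_n(t)BR^{-1}B^*\eta_n(t),\qquad \eta_n(0)=-\overline Q_TS_T.$$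
   Context: $H,K,U$ are separable real Hilbert spaces. $\mathcal L(\cdot;\cdot)$ denotes bounded linear operators with the operator norm, $\mathcal L(H)=\mathcal L(H;H)$; $\Sigma(H)$ is the set of self-adjoint operators in $\mathcal L(H)$, $\Sigma^+(H)$ the set of nonnegative ones in $\Sigma(H)$ (similarly for $U$). Standing assumptions: $A:D(A)\subset H\to H$ is closed, densely defined and generates a $C_0$-semigroup $(e^{tA})_{t\ge0}$ on $H$; $B\in\mathcal L(U;H)$; $Q,Q_T\in\Sigma^+(H)$; $\overline Q,\overline Q_T\in\Sigma(H)$; $Q+\overline Q,\ Q_T+\overline Q_T\in\Sigma^+(H)$; $R\in\Sigma(U)$ with $\langle R\alpha,\alpha\rangle_U\ge\varepsilon|\alpha|_U^2$ for all $\alpha\in U$ and some $\varepsilon>0$; $S,S_T\in\mathcal L(H)$; $\sigma\in\mathcal L(K;H)$; $T>0$. $M\ge1$ and $\omega\in\mathbb R$ are such that $\|e^{tA}\|_{\mathcal L(H)}\le Me^{\omega t}$ for all $t\ge0$. $R(n,A)=(nI-A)^{-1}$ is the resolvent of $A$, and the index $n$ of the Yosida approximations $A_n\in\mathcal L(H)$ ranges over positive integers with $n>\omega$. $C_s([0,T];\Sigma^+(H))$ is the space of strongly continuous maps $f:[0,T]\to\Sigma^+(H)$, i.e. $t\mapsto f(t)x$ is continuous for each $x\in H$; $C^1_s([0,\tau];\Sigma(H))$ is the space of maps $f:[0,\tau]\to\Sigma(H)$ with $t\mapsto f(t)x$ of class $C^1$ for each $x\in H$. A strict solution on $[0,\tau]$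 is such a map satisfying the initial condition and, for all $t\in[0,\tau]$, $x\in H$, the equation applied to $x$, with $\eta_n'(t)x:=\frac{d}{dt}(\eta_n(t)x)$. Mild solution of the Riccati equation for $P$: $P\in C_s([0,T];\Sigma^+(H))$ such that for all $x\in H$, $t\in[0,T]$, $$P(t)x=e^{(T-t)A^*}(Q_T+\overline Q_T)e^{(T-t)A}x+\int_t^Te^{(s-t)A^*}(Q+\overline Q)e^{(s-t)A}x\,ds-\int_t^Te^{(s-t)A^*}P(s)BR^{-1}B^*P(s)e^{(s-t)A}x\,ds .$$ It is known that such a $P$ exists and is unique.
   Formalization: Values of η_n in Σ(H) are impossible unless Q̄S and Q̄_T S_T are self-adjoint, which is not assumed; the formal theorem gives a unique strict solution with values in L(H) in general, and with values in Σ(H) exactly when both products are self-adjoint. *)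

theory Defs
  imports "HOL-Analysis.Analysis"
begin

text \<open>Separable real Hilbert spaces are types of sort \<open>{real_inner, banach, second_countable_topology}\<close>.
  The definitions below only ask for the sort that their formulation needs; the library functions
  \<open>adjoint\<close> and \<open>inv\<close> return plain functions, whose boundedness on
  Hilbert spaces comes from the Riesz and the bounded inverse theorem.\<close>

definition adj :: "'a::real_inner \<Rightarrow>\<^sub>L 'b::real_inner \<Rightarrow> 'b \<Rightarrow>\<^sub>L 'a" where
  "adj F = Blinfun (adjoint (blinfun_apply F))"

definition bounded_inverse :: "'a::real_normed_vector \<Rightarrow>\<^sub>L 'b::real_normed_vector \<Rightarrow> 'b \<Rightarrow>\<^sub>L 'a" where
  "bounded_inverse F = Blinfun (inv (blinfun_apply F))"

definition selfadjoint_ops :: "('a::real_inner \<Rightarrow>\<^sub>L 'a) set" where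
  "selfadjoint_ops = {F :: 'a \<Rightarrow>\<^sub>L 'a. \<forall>x y. F x \<bullet> y = x \<bullet> F y}"

definition nonneg_ops :: "('a::real_inner \<Rightarrow>\<^sub>L 'a) set" where
  "nonneg_ops = {F \<in> selfadjoint_ops. \<forall>x. F x \<bullet> x \<ge> 0}"


text \<open>An unbounded operator is a pair of a domain \<open>D\<close> and a function \<open>A\<close> whose values outside
  \<open>D\<close> are irrelevant.\<close>

definition closed_densely_defined :: "'a::real_normed_vector set \<Rightarrow> ('a \<Rightarrow> 'a) \<Rightarrow> bool" where
  "closed_densely_defined D A \<longleftrightarrow>
     subspace D \<and> (\<forall>x\<in>D. \<forall>y\<in>D. A (x + y) = A x + A y) \<and> (\<forall>c. \<forall>x\<in>D. A (c *\<^sub>R x) = c *\<^sub>R A x)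
     \<and> closed {(x, A x) | x. x \<in> D} \<and> closure D = UNIV"

text \<open>Only the values \<open>E t\<close> for \<open>t \<ge> 0\<close> matter.\<close>

definition C0_semigroup :: "(real \<Rightarrow> 'a::real_normed_vector \<Rightarrow>\<^sub>L 'a) \<Rightarrow> bool" where
  "C0_semigroup E \<longleftrightarrow>
     E 0 = id_blinfun \<and> (\<forall>s\<ge>0. \<forall>t\<ge>0. E (s + t) = E s o\<^sub>L E t)
     \<and> (\<forall>x. ((\<lambda>t. E t x) \<longlongrightarrow> x) (at_right 0))"

definition is_generator ::
  "'a::real_normed_vector set \<Rightarrow> ('a \<Rightarrow> 'a) \<Rightarrow> (real \<Rightarrow> 'a \<Rightarrow>\<^sub>L 'a) \<Rightarrow> bool" where
  "is_generator D A E \<longleftrightarrow>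
     D = {x. \<exists>y. ((\<lambda>t. (E t x - x) /\<^sub>R t) \<longlongrightarrow> y) (at_right 0)}
     \<and> (\<forall>x\<in>D. ((\<lambda>t. (E t x - x) /\<^sub>R t) \<longlongrightarrow> A x) (at_right 0))"

definition resolvent_op :: "'a::real_normed_vector set \<Rightarrow> ('a \<Rightarrow> 'a) \<Rightarrow> real \<Rightarrow> 'a \<Rightarrow>\<^sub>L 'a" where
  "resolvent_op D A z = Blinfun (inv_into D (\<lambda>x. z *\<^sub>R x - A x))"

definition yosida :: "'a::real_normed_vector set \<Rightarrow> ('a \<Rightarrow> 'a) \<Rightarrow> nat \<Rightarrow> 'a \<Rightarrow>\<^sub>L 'a" where
  "yosida D A n = (real n)\<^sup>2 *\<^sub>R resolvent_op D A (real n) - real n *\<^sub>R id_blinfun"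


text \<open>\<open>C\<^sub>s(I; X)\<close> and \<open>C\<^sup>1\<^sub>s(I; X)\<close>; derivatives are taken within \<open>I\<close>, hence one-sided at the
  endpoints of a compact interval.\<close>

definition Cs :: "real set \<Rightarrow> ('a::real_normed_vector \<Rightarrow>\<^sub>L 'b::real_normed_vector) set
    \<Rightarrow> (real \<Rightarrow> 'a \<Rightarrow>\<^sub>L 'b) set" where
  "Cs I X = {f. (\<forall>t\<in>I. f t \<in> X) \<and> (\<forall>x. continuous_on I (\<lambda>t. f t x))}"

definition C1s :: "real set \<Rightarrow> ('a::real_normed_vector \<Rightarrow>\<^sub>L 'b::real_normed_vector) set
    \<Rightarrow> (real \<Rightarrow> 'a \<Rightarrow>\<^sub>L 'b) set" where
  "C1s I X = {f. (\<forall>t\<in>I. f t \<in> X) \<and>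
     (\<forall>x. \<exists>g. continuous_on I g \<and> (\<forall>t\<in>I. ((\<lambda>s. f s x) has_vector_derivative g t) (at t within I)))}"


definition control_op :: "'u::real_inner \<Rightarrow>\<^sub>L 'h::real_inner \<Rightarrow> 'u \<Rightarrow>\<^sub>L 'u \<Rightarrow> 'h \<Rightarrow>\<^sub>L 'h" where
  "control_op B R = B o\<^sub>L bounded_inverse R o\<^sub>L adj B"

text \<open>Mild solution on \<open>[0, T]\<close> of
  \<open>P' + P A + A\<^sup>* P - P G P + W = 0\<close>, \<open>P(T) = W\<^sub>T\<close>, where \<open>A\<close> generates \<open>E\<close>; the semigroup
  \<open>e\<^sup>t\<^sup>A\<^sup>*\<close> is \<open>adj (E t)\<close>.\<close>

definition riccati_mild_solution ::
  "(real \<Rightarrow> 'h \<Rightarrow>\<^sub>L 'h) \<Rightarrow> 'h \<Rightarrow>\<^sub>L 'h \<Rightarrow> 'h \<Rightarrow>\<^sub>L 'h \<Rightarrow> 'h \<Rightarrow>\<^sub>L 'h \<Rightarrow> real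
     \<Rightarrow> (real \<Rightarrow> 'h::{real_inner, banach} \<Rightarrow>\<^sub>L 'h) \<Rightarrow> bool" where
  "riccati_mild_solution E G W W\<^sub>T T P \<longleftrightarrow>
     P \<in> Cs {0..T} nonneg_ops \<and>
     (\<forall>x. \<forall>t\<in>{0..T}. P t x =
        adj (E (T - t)) (W\<^sub>T (E (T - t) x))
        + integral {t..T} (\<lambda>s. adj (E (s - t)) (W (E (s - t) x)))
        - integral {t..T} (\<lambda>s. adj (E (s - t)) (P s (G (P s (E (s - t) x))))))"

text \<open>Strict solution on \<open>[0, \<tau>]\<close>, with values in \<open>X\<close>, of
  \<open>\<eta>'(t) = (- P(T - t) G + L\<^sup>*) \<eta>(t) + \<eta>(t) (L - G P(T - t)) - F - \<eta>(t) G \<eta>(t)\<close>, \<open>\<eta>(0) = \<eta>\<^sub>0\<close>,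
  for a bounded operator \<open>L\<close>.\<close>

definition riccati_strict_solution ::
  "('h \<Rightarrow>\<^sub>L 'h) set \<Rightarrow> real \<Rightarrow> 'h \<Rightarrow>\<^sub>L 'h \<Rightarrow> 'h \<Rightarrow>\<^sub>L 'h \<Rightarrow> real \<Rightarrow> (real \<Rightarrow> 'h \<Rightarrow>\<^sub>L 'h)
     \<Rightarrow> 'h \<Rightarrow>\<^sub>L 'h \<Rightarrow> 'h \<Rightarrow>\<^sub>L 'h \<Rightarrow> (real \<Rightarrow> 'h::real_inner \<Rightarrow>\<^sub>L 'h) \<Rightarrow> bool" where
  "riccati_strict_solution X \<tau> L G T P F \<eta>\<^sub>0 \<eta> \<longleftrightarrow>
     \<eta> \<in> C1s {0..\<tau>} X \<and> \<eta> 0 = \<eta>\<^sub>0 \<and>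
     (\<forall>t\<in>{0..\<tau>}. \<forall>x. ((\<lambda>s. \<eta> s x) has_vector_derivative
        ((- (P (T - t) o\<^sub>L G) + adj L) o\<^sub>L \<eta> t) x
        + (\<eta> t o\<^sub>L (L - (G o\<^sub>L P (T - t)))) x
        - F x - (\<eta> t o\<^sub>L G o\<^sub>L \<eta> t) x) (at t within {0..\<tau>}))"

text \<open>Functions are total, so solutions are compared on \<open>[0, \<tau>]\<close> only.\<close>

definition riccati_unique_strict_solution ::
  "('h \<Rightarrow>\<^sub>L 'h) set \<Rightarrow> real \<Rightarrow> 'h \<Rightarrow>\<^sub>L 'h \<Rightarrow> 'h \<Rightarrow>\<^sub>L 'h \<Rightarrow> real \<Rightarrow> (real \<Rightarrow> 'h \<Rightarrow>\<^sub>L 'h)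
     \<Rightarrow> 'h \<Rightarrow>\<^sub>L 'h \<Rightarrow> 'h::real_inner \<Rightarrow>\<^sub>L 'h \<Rightarrow> bool" where
  "riccati_unique_strict_solution X \<tau> L G T P F \<eta>\<^sub>0 \<longleftrightarrow>
     (\<exists>\<eta>. riccati_strict_solution X \<tau> L G T P F \<eta>\<^sub>0 \<eta> \<and>
        (\<forall>\<zeta>. riccati_strict_solution X \<tau> L G T P F \<eta>\<^sub>0 \<zeta> \<longrightarrow> (\<forall>t\<in>{0..\<tau>}. \<zeta> t = \<eta> t)))"

end

theory Submission
  imports Defs
begin

text \<open>
  For a bounded operator \<open>A\<^sub>n\<close> the forward Riccati equation is an ordinary differential equation in the space of bounded
  operators with a locally Lipschitz nonlinearity, so for each \<open>n\<close> it has a unique local solution. The point is that the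
  length of the interval does not depend on \<open>n\<close>, although the norms of the \<open>A\<^sub>n\<close> are unbounded when \<open>A\<close> is.

  The reason is that the semigroups generated by the \<open>A\<^sub>n\<close> are exponentially bounded uniformly in \<open>n\<close>. This is used here
  without operator exponentials. In the equivalent norm \<open>p x = sup\<^sub>t exp (- \<omega> t) * norm (e\<^sup>t\<^sup>A x)\<close> the resolvent satisfies
  \<open>p (R(n,A) x) \<le> p x / (n - \<omega>)\<close> (lemmas \<open>renorm_dissipative\<close> and \<open>resolvent_surj\<close>), hence
  \<open>p (A\<^sub>n x + n x) \<le> (n + c) p x\<close> with \<open>c\<close> independent of \<open>n\<close> (lemmas \<open>renorm_yosida\<close> and \<open>yosida_growth_bound\<close>). The operator
  \<open>\<eta>\<close> is measured by the least \<open>r\<close> with \<open>\<bar>\<eta> x \<bullet> y\<bar> \<le> r * p x * p y\<close>. In this norm the linear part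
  \<open>A\<^sub>n\<^sup>* \<eta> + \<eta> A\<^sub>n + 2 n \<eta>\<close> is at most \<open>2 (n + c) r\<close>, while the term \<open>- 2 n \<eta>\<close>, absorbed into an integrating factor,
  compensates \<open>2 n r\<close>. So the norm of \<open>\<eta>\<close> grows at most like the solution of a scalar equation in which \<open>n\<close> does
  not occur, and there is a tube, of width and length independent of \<open>n\<close>, that the Picard map leaves invariant
  (lemma \<open>strict_solution_exists\<close>). The Lipschitz constant of the Picard map in the tube does depend on \<open>n\<close>, but an exponential
  weight in time, which may depend on \<open>n\<close>, makes it a contraction on the whole interval (lemma \<open>strong_picard_in_form_balls\<close>).

  Uniqueness is Gronwall's inequality. It applies because strict solutions are bounded, by the uniform boundedness principle;
  the same principle bounds \<open>P\<close>. When the data are self-adjoint, the adjoint of the solution is again a solution, in a weak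
  sense that suffices for Gronwall's inequality, and so equals it.
\<close>

section \<open>Uniform boundedness, adjoints and coercive operators\<close>

text \<open>Baire: the closed sets \<open>U k\<close> on which all operators are bounded by \<open>k\<close> cover the space, so one of
  them contains a ball, and a bound on a ball is a bound on the operator norms.\<close>

lemma uniform_boundedness:
  fixes F :: "('a::banach \<Rightarrow>\<^sub>L 'b::real_normed_vector) set"
  assumes "\<And>x. bounded ((\<lambda>f. blinfun_apply f x) ` F)"
  shows "bounded F"
proof -
  define U where "U k = {x. \<forall>f\<in>F. norm (blinfun_apply f x) \<le> real k}" for k :: nat
  have clU: "closed (U k)" for k
  proof -
    have "U k = (\<Inter>f\<in>F. {x. norm (blinfun_apply f x) \<le> real k})" by (auto simp: U_def)
    then show ?thesis by (auto intro!: closed_INT closed_Collect_le continuous_intros)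
  qed
  have UNIVU: "\<Union>(range U) = UNIV"
  proof -
    have "\<exists>k. x \<in> U k" for x
    proof -
      obtain a where a: "\<And>f. f \<in> F \<Longrightarrow> norm (blinfun_apply f x) \<le> a"
        using assms[of x] unfolding bounded_iff by blast
      obtain k where k: "a \<le> real k" using real_arch_simple by blast
      have "x \<in> U k" unfolding U_def using order_trans[OF a k] by blast
      then show ?thesis by blast
    qed
    then show ?thesis by blast
  qed
  have "\<exists>k. interior (U k) \<noteq> {}"
  proof (rule ccontr)
    assume "\<nexists>k. interior (U k) \<noteq> {}"
    then have "euclidean interior_of \<Union>(range U) = ({}::'a set)"
      by (intro Baire_category_alt) (auto simp: clU completely_metrizable_space_euclidean)
    then show False by (simp add: UNIVU)
  qed
  then obtain k x r where r: "r > 0" "cball x r \<subseteq> U k"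
    by (metis all_not_in_conv mem_interior_cball)
  have "norm f \<le> 2 * real k / r" if f: "f \<in> F" for f
  proof (rule norm_blinfun_bound)
    fix z
    show "norm (blinfun_apply f z) \<le> 2 * real k / r * norm z"
    proof (cases "z = 0")
      case False
      define c where "c = r / norm z"
      have c: "c > 0" using False r by (simp add: c_def)
      have "x + c *\<^sub>R z \<in> U k" "x \<in> U k"
        using r False by (auto intro!: subsetD[OF r(2)] simp: dist_norm c_def)
      then have "norm (f (x + c *\<^sub>R z)) \<le> k" "norm (f x) \<le> k"
        using f by (auto simp: U_def)
      moreover have "c *\<^sub>R f z = f (x + c *\<^sub>R z) - f x"
        by (simp add: blinfun.bilinear_simps)
      ultimately have "norm (c *\<^sub>R f z) \<le> 2 * k"
        using norm_triangle_ineq4[of "f (x + c *\<^sub>R z)" "f x"] by simp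
      then show ?thesis using c r False by (simp add: c_def field_simps)
    qed simp
  qed (use r in simp)
  then show ?thesis by (auto simp: bounded_iff)
qed

text \<open>The representing vector is the minimiser of \<open>J x = (norm x)\<^sup>2 / 2 - g x\<close>: minimising sequences are Cauchy
  by the parallelogram identity, and \<open>g y = z \<bullet> y\<close> is the vanishing of the first variation of \<open>J\<close> at \<open>z\<close>.\<close>

lemma riesz_representation:
  fixes g :: "'h::{real_inner, banach} \<Rightarrow> real"
  assumes g: "bounded_linear g"
  shows "\<exists>z. \<forall>y. g y = z \<bullet> y"
proof -
  interpret g: bounded_linear g by (rule g)
  define J where "J x = (norm x)\<^sup>2 / 2 - g x" for x
  obtain K where K: "\<And>x. \<bar>g x\<bar> \<le> norm x * K"
    using g.bounded by auto
  have below: "- (K\<^sup>2 / 2) \<le> J x" for x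
  proof -
    have "0 \<le> (norm x - K)\<^sup>2" by simp
    then show ?thesis using K[of x] unfolding J_def by (simp add: power2_eq_square algebra_simps)
  qed
  define m where "m = Inf (range J)"
  have bdd: "bdd_below (range J)" using below by (auto simp: bdd_below_def)
  have m_le: "m \<le> J x" for x unfolding m_def by (intro cInf_lower bdd) auto
  have "\<exists>x. J x < m + inverse (Suc k)" for k :: nat
    using cInf_lessD[of "range J" "m + inverse (Suc k)"] by (auto simp: m_def)
  then obtain x where x: "\<And>k. J (x k) < m + inverse (Suc k)" by metis
  have par: "(norm (a - b))\<^sup>2 / 4 = J a + J b - 2 * J ((a + b) /\<^sub>R 2)" for a b
    unfolding J_def power2_norm_eq_inner
    by (simp add: g.scaleR g.add inner_diff_left inner_diff_right inner_add_left inner_add_right inner_commute field_simps)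
  have dist_bd: "(norm (x i - x j))\<^sup>2 \<le> 4 * (inverse (Suc i) + inverse (Suc j))" for i j
  proof -
    have "a / 4 = b + c - 2 * d \<Longrightarrow> m \<le> d \<Longrightarrow> b < m + u \<Longrightarrow> c < m + v \<Longrightarrow> a \<le> 4 * (u + v)"
      for a b c d u v :: real by argo
    from this[OF par m_le x x] show ?thesis .
  qed
  have "Cauchy x"
  proof (rule metric_CauchyI)
    fix e :: real assume e: "e > 0"
    then have "e\<^sup>2 / 8 > 0" by simp
    then obtain N where N: "inverse (real (Suc N)) < e\<^sup>2 / 8"
      using reals_Archimedean by blast
    have "dist (x i) (x j) < e" if "i \<ge> N" "j \<ge> N" for i j
    proof -
      have "inverse (real (Suc i)) \<le> inverse (real (Suc N))" "inverse (real (Suc j)) \<le> inverse (real (Suc N))"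
        using that by auto
      moreover have "u \<le> w \<Longrightarrow> v \<le> w \<Longrightarrow> w < E / 8 \<Longrightarrow> 4 * (u + v) < E" for u v w E :: real by simp
      ultimately have "4 * (inverse (real (Suc i)) + inverse (real (Suc j))) < e\<^sup>2" using N by blast
      then have "(norm (x i - x j))\<^sup>2 < e\<^sup>2" by (rule le_less_trans[OF dist_bd])
      then show ?thesis using e by (simp add: dist_norm power2_less_imp_less)
    qed
    then show "\<exists>M. \<forall>m\<ge>M. \<forall>n\<ge>M. dist (x m) (x n) < e" by blast
  qed
  then obtain z where z: "x \<longlonglongrightarrow> z" using Cauchy_convergent convergent_def by blast
  have Jz: "(\<lambda>k. J (x k)) \<longlonglongrightarrow> J z"
    unfolding J_def by (intro tendsto_intros g.tendsto z) simp
  have "J z \<le> m"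
  proof (rule LIMSEQ_le[OF Jz])
    show "(\<lambda>k. m + inverse (real (Suc k))) \<longlonglongrightarrow> m"
      using tendsto_add[OF tendsto_const LIMSEQ_inverse_real_of_nat, of m] by simp
    show "\<exists>N. \<forall>n\<ge>N. J (x n) \<le> m + inverse (real (Suc n))" using x less_imp_le by blast
  qed
  then have min: "J z \<le> J y" for y using m_le[of y] by linarith
  have "g y = z \<bullet> y" for y
  proof (rule ccontr)
    assume "g y \<noteq> z \<bullet> y"
    define d where "d = g y - z \<bullet> y"
    have d: "d \<noteq> 0" using \<open>g y \<noteq> z \<bullet> y\<close> by (simp add: d_def)
    have y: "y \<noteq> 0" using d by (auto simp: d_def g.zero)
    \<comment> \<open>the second-order expansion of \<open>J\<close> at \<open>z\<close>; the step \<open>t = d / (norm y)\<^sup>2\<close> below minimises it\<close>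
    have exp: "J (z + t *\<^sub>R y) = J z - t * d + t\<^sup>2 * (norm y)\<^sup>2 / 2" for t
      unfolding J_def d_def power2_norm_eq_inner
      by (simp add: g.scaleR g.add inner_add_left inner_add_right inner_commute field_simps power2_eq_square)
    have "t * d \<le> t\<^sup>2 * (norm y)\<^sup>2 / 2" for t using min[of "z + t *\<^sub>R y"] exp[of t] by linarith
    from this[of "d / (norm y)\<^sup>2"] have "d\<^sup>2 / (norm y)\<^sup>2 \<le> d\<^sup>2 / (norm y)\<^sup>2 / 2"
      using y by (simp add: power2_eq_square field_simps)
    moreover have "d\<^sup>2 / (norm y)\<^sup>2 > 0" using d y by simp
    moreover have "c \<le> c / 2 \<Longrightarrow> c > 0 \<Longrightarrow> False" for c :: real by simp
    ultimately show False by blast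
  qed
  then show ?thesis by blast
qed

text \<open>The Riesz theorem provides the function that the choice operator in \<open>adjoint\<close> asks for, and its boundedness makes
  \<open>Blinfun\<close> meaningful in \<open>adj\<close>.\<close>

lemma inner_adj:
  fixes F :: "'a::{real_inner, banach} \<Rightarrow>\<^sub>L 'b::real_inner"
  shows "blinfun_apply (adj F) y \<bullet> x = y \<bullet> F x"
proof -
  have "\<exists>z. \<forall>x. F x \<bullet> y = z \<bullet> x" for y
    by (rule riesz_representation) (intro bounded_linear_intros)
  then obtain f' where f': "\<And>x y. F x \<bullet> y = f' y \<bullet> x" by metis
  have eq: "adjoint (blinfun_apply F) = f'"
    by (rule adjoint_unique) (metis f' inner_commute)
  have "bounded_linear f'"
  proof (rule bounded_linear_intro)
    show "f' (x + y) = f' x + f' y" for x y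
      by (rule vector_eq_rdot[THEN iffD1]) (simp add: inner_add_left inner_add_right flip: f')
    show "f' (r *\<^sub>R x) = r *\<^sub>R f' x" for r x
      by (rule vector_eq_rdot[THEN iffD1]) (simp flip: f')
    show "norm (f' y) \<le> norm y * norm F" for y
    proof -
      have "(norm (f' y))\<^sup>2 = F (f' y) \<bullet> y" by (simp add: f' power2_norm_eq_inner)
      also have "\<dots> \<le> (norm F * norm (f' y)) * norm y"
        by (meson norm_blinfun norm_cauchy_schwarz norm_ge_zero mult_right_mono order_trans)
      finally have "norm (f' y) * norm (f' y) \<le> (norm y * norm F) * norm (f' y)"
        by (simp add: power2_eq_square mult_ac)
      then show ?thesis
        by (cases "f' y = 0") (auto simp: mult_le_cancel_right)
    qed
  qed
  then show ?thesis
    unfolding adj_def eq bounded_linear_Blinfun_apply[OF \<open>bounded_linear f'\<close>]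
    by (metis f' inner_commute)
qed

lemma blinfun_eq_weakI:
  assumes "\<And>x y. blinfun_apply F x \<bullet> y = blinfun_apply G x \<bullet> y"
  shows "F = (G :: 'a::real_normed_vector \<Rightarrow>\<^sub>L 'b::real_inner)"
  using assms by (intro blinfun_eqI vector_eq_rdot[THEN iffD1]) blast

lemma norm_le_weakI:
  assumes "0 \<le> b" "\<And>x y. \<bar>blinfun_apply F x \<bullet> y\<bar> \<le> b * norm x * norm y"
  shows "norm (F :: 'a::real_normed_vector \<Rightarrow>\<^sub>L 'b::real_inner) \<le> b"
proof (rule norm_blinfun_bound)
  fix x
  have "norm (F x) * norm (F x) \<le> (b * norm x) * norm (F x)"
    using assms(2)[of x "F x"] by (simp add: power2_norm_eq_inner flip: power2_eq_square)
  then show "norm (F x) \<le> b * norm x"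
    by (cases "F x = 0") (auto simp: mult_le_cancel_right assms)
qed (rule assms)

lemma inner_blinfun_le:
  "\<bar>blinfun_apply F x \<bullet> y\<bar> \<le> norm (F :: 'a::real_normed_vector \<Rightarrow>\<^sub>L 'b::real_inner) * norm x * norm y"
  by (meson Cauchy_Schwarz_ineq2 mult_right_mono norm_blinfun norm_ge_zero order_trans)

text \<open>For surjectivity, \<open>\<rho> > 0\<close> is chosen such that \<open>a \<mapsto> a - \<rho> *\<^sub>R R a\<close> contracts with factor
  \<open>sqrt (1 - \<rho> * \<epsilon>)\<close>; the fixed point of \<open>a \<mapsto> a - \<rho> *\<^sub>R R a + \<rho> *\<^sub>R y\<close> is a preimage of \<open>y\<close>.\<close>

lemma coercive_bij:
  fixes R :: "'u::{real_inner, banach} \<Rightarrow>\<^sub>L 'u"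
  assumes e: "\<epsilon> > 0" and coer: "\<And>a. R a \<bullet> a \<ge> \<epsilon> * (norm a)\<^sup>2"
  shows "bij R"
proof -
  have lower: "\<epsilon> * norm a \<le> norm (R a)" for a
  proof -
    have "\<epsilon> * norm a * norm a \<le> norm (R a) * norm a"
      using coer[of a] norm_cauchy_schwarz[of "R a" a] by (simp add: power2_eq_square)
    then show ?thesis by (cases "a = 0") (auto simp: mult_le_cancel_right)
  qed
  have "inj R"
  proof (rule injI)
    fix a b assume "R a = R b"
    then have "R (a - b) = 0" by (simp add: blinfun.diff_right)
    then have "\<epsilon> * norm (a - b) \<le> 0" using lower[of "a - b"] by simp
    then show "a = b" using e by (simp add: mult_le_0_iff)
  qed
  moreover have "surj R"
  proof (unfold surj_def, rule allI)
    fix y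
    \<comment> \<open>a bound of the norm of \<open>R\<close>; taking it at least \<open>\<epsilon>\<close> keeps \<open>q\<close> nonnegative\<close>
    define N where "N = max (norm R) \<epsilon>"
    define \<rho> where "\<rho> = \<epsilon> / N\<^sup>2"
    have N: "N > 0" "norm R \<le> N" "\<epsilon> \<le> N" using e by (auto simp: N_def)
    have \<rho>: "\<rho> > 0" using e N by (simp add: \<rho>_def)
    define q where "q = 1 - \<rho> * \<epsilon>"
    have q: "0 \<le> q" "q < 1"
    proof -
      have "\<epsilon> * \<epsilon> \<le> N * N" using N e by (intro mult_mono) auto
      then show "0 \<le> q" using N by (simp add: q_def \<rho>_def field_simps power2_eq_square)
      show "q < 1" using \<rho> e by (simp add: q_def)
    qed
    have contr: "norm (a - \<rho> *\<^sub>R R a) \<le> sqrt q * norm a" for a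
    proof (rule power2_le_imp_le)
      have "(norm (R a))\<^sup>2 \<le> (N * norm a)\<^sup>2"
        by (meson N(2) mult_right_mono norm_blinfun norm_ge_zero order_trans power_mono)
      then have "\<rho>\<^sup>2 * (norm (R a))\<^sup>2 \<le> \<rho>\<^sup>2 * (N * norm a)\<^sup>2"
        by (intro mult_left_mono) auto
      also have "\<dots> = \<rho> * \<epsilon> * (norm a)\<^sup>2" using N by (simp add: \<rho>_def power2_eq_square field_simps)
      finally have 1: "\<rho>\<^sup>2 * (norm (R a))\<^sup>2 \<le> \<rho> * \<epsilon> * (norm a)\<^sup>2" .
      have 2: "\<rho> * (\<epsilon> * (norm a)\<^sup>2) \<le> \<rho> * (R a \<bullet> a)"
        using \<rho> coer[of a] by (intro mult_left_mono) auto
      have "(norm (a - \<rho> *\<^sub>R R a))\<^sup>2 = (norm a)\<^sup>2 - 2 * (\<rho> * (R a \<bullet> a)) + \<rho>\<^sup>2 * (norm (R a))\<^sup>2"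
        unfolding power2_norm_eq_inner
        by (simp add: inner_diff_left inner_diff_right inner_commute algebra_simps power2_eq_square)
      also have "\<dots> \<le> q * (norm a)\<^sup>2" using 1 2 by (simp add: q_def algebra_simps)
      also have "\<dots> = (sqrt q * norm a)\<^sup>2" using q by (simp add: power_mult_distrib)
      finally show "(norm (a - \<rho> *\<^sub>R R a))\<^sup>2 \<le> (sqrt q * norm a)\<^sup>2" .
    qed (use q in simp)
    have "\<exists>!a. a - \<rho> *\<^sub>R R a + \<rho> *\<^sub>R y = a"
    proof (rule banach_fix_type[of "sqrt q"])
      have "a - \<rho> *\<^sub>R R a + \<rho> *\<^sub>R y - (b - \<rho> *\<^sub>R R b + \<rho> *\<^sub>R y) = (a - b) - \<rho> *\<^sub>R R (a - b)" for a b
        by (simp add: blinfun.diff_right scaleR_diff_right)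
      then show "\<forall>a b. dist (a - \<rho> *\<^sub>R R a + \<rho> *\<^sub>R y) (b - \<rho> *\<^sub>R R b + \<rho> *\<^sub>R y) \<le> sqrt q * dist a b"
        using contr by (intro allI) (simp only: dist_norm)
    qed (use q in auto)
    then obtain a where "a - \<rho> *\<^sub>R R a + \<rho> *\<^sub>R y = a" by blast
    then have "\<rho> *\<^sub>R y = \<rho> *\<^sub>R R a" by (simp add: algebra_simps)
    then show "\<exists>a. y = R a" using \<rho> by auto
  qed
  ultimately show ?thesis by (simp add: bij_def)
qed

lemma coercive_bounded_inverse:
  fixes R :: "'u::{real_inner, banach} \<Rightarrow>\<^sub>L 'u"
  assumes e: "\<epsilon> > 0" and coer: "\<And>a. R a \<bullet> a \<ge> \<epsilon> * (norm a)\<^sup>2"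
  shows "R (bounded_inverse R y) = y"
proof -
  have bij: "bij R" by (rule coercive_bij[OF assms])
  have Ri: "R (inv R y) = y" for y using bij by (simp add: bij_is_surj surj_f_inv_f)
  have "bounded_linear (inv R)"
  proof (rule bounded_linear_intro)
    show "inv R (x + y) = inv R x + inv R y" for x y
      by (rule injD[OF bij_is_inj[OF bij]]) (simp add: Ri blinfun.add_right)
    show "inv R (r *\<^sub>R x) = r *\<^sub>R inv R x" for r x
      by (rule injD[OF bij_is_inj[OF bij]]) (simp add: Ri blinfun.scaleR_right)
    show "norm (inv R x) \<le> norm x * (1 / \<epsilon>)" for x
    proof -
      let ?a = "inv R x"
      have "\<epsilon> * norm ?a * norm ?a \<le> norm x * norm ?a"
        using coer[of ?a] norm_cauchy_schwarz[of "R ?a" ?a] by (simp add: power2_eq_square Ri)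
      then have "\<epsilon> * norm ?a \<le> norm x" by (cases "?a = 0") (auto simp: mult_le_cancel_right)
      then show ?thesis using e by (simp add: field_simps)
    qed
  qed
  then show ?thesis by (simp add: bounded_inverse_def bounded_linear_Blinfun_apply Ri)
qed

lemma control_op_selfadjoint:
  fixes R :: "'u::{real_inner, banach} \<Rightarrow>\<^sub>L 'u" and B :: "'u \<Rightarrow>\<^sub>L 'h::{real_inner, banach}"
  assumes "\<epsilon> > 0" "\<And>a. R a \<bullet> a \<ge> \<epsilon> * (norm a)\<^sup>2" and sa: "R \<in> selfadjoint_ops"
  shows "control_op B R \<in> selfadjoint_ops"
proof -
  note inv = coercive_bounded_inverse[OF assms(1,2)]
  have bi: "bounded_inverse R u \<bullet> v = u \<bullet> bounded_inverse R v" for u v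
  proof -
    have "bounded_inverse R u \<bullet> R (bounded_inverse R v) = R (bounded_inverse R u) \<bullet> bounded_inverse R v"
      using sa by (simp add: selfadjoint_ops_def)
    then show ?thesis by (simp only: inv)
  qed
  have "control_op B R x \<bullet> y = x \<bullet> control_op B R y" for x y
  proof -
    have "control_op B R x \<bullet> y = bounded_inverse R (adj B x) \<bullet> adj B y"
      by (simp add: control_op_def inner_commute[of _ y] inner_commute[of _ "adj B y"] inner_adj)
    also have "\<dots> = adj B x \<bullet> bounded_inverse R (adj B y)" by (rule bi)
    finally show ?thesis by (simp add: control_op_def inner_adj)
  qed
  then show ?thesis by (simp add: selfadjoint_ops_def)
qed

section \<open>An equivalent norm for the semigroup and its Yosida approximations\<close>

lemma right_quotient_tendsto:
  fixes f :: "real \<Rightarrow> 'a::real_normed_vector"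
  assumes "(f has_vector_derivative d) (at 0 within {0..b})" "b > 0"
  shows "((\<lambda>h. (f h - f 0) /\<^sub>R h) \<longlongrightarrow> d) (at_right 0)"
proof -
  have "((\<lambda>h. (1 / norm (h - 0)) *\<^sub>R (f h - (f 0 + (h - 0) *\<^sub>R d))) \<longlongrightarrow> 0) (at_right 0)"
    using assms by (simp add: has_vector_derivative_def has_derivative_within at_within_Icc_at_right)
  then have "((\<lambda>h. (f h - f 0) /\<^sub>R h - d) \<longlongrightarrow> 0) (at_right 0)"
  proof (rule Lim_transform_eventually)
    show "\<forall>\<^sub>F h in at_right 0. (1 / norm (h - 0)) *\<^sub>R (f h - (f 0 + (h - 0) *\<^sub>R d)) = (f h - f 0) /\<^sub>R h - d"
      using eventually_at_right_less[of "0::real"]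
      by eventually_elim (simp add: algebra_simps divide_inverse)
  qed
  then show ?thesis by (simp add: LIM_zero_iff)
qed

locale exp_bounded_semigroup =
  fixes E :: "real \<Rightarrow> 'h::banach \<Rightarrow>\<^sub>L 'h" and M \<omega> :: real
  assumes semigroup: "C0_semigroup E"
    and bound: "\<And>t. t \<ge> 0 \<Longrightarrow> norm (E t) \<le> M * exp (\<omega> * t)"
begin

lemma E_0: "E 0 = id_blinfun" and E_add: "s \<ge> 0 \<Longrightarrow> t \<ge> 0 \<Longrightarrow> E (s + t) x = E s (E t x)"
  and E_right: "((\<lambda>t. E t x) \<longlongrightarrow> x) (at_right 0)"
  using semigroup by (auto simp: C0_semigroup_def)

lemma M_nonneg: "0 \<le> M"
  using order_trans[OF norm_ge_zero bound[of 0]] by simp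

text \<open>In the original norm a factor \<open>M\<close> would be lost in each use of the resolvent, and the Yosida approximations could only
  be controlled through all powers of the resolvent. In the equivalent norm \<open>renorm\<close> the semigroup
  satisfies the same bound with \<open>M = 1\<close>, so the resolvent estimate needs no powers.\<close>

definition renorm :: "'h \<Rightarrow> real" where
  "renorm x = (SUP t\<in>{0..}. exp (- \<omega> * t) * norm (E t x))"

lemma renorm_term_le: "t \<ge> 0 \<Longrightarrow> exp (- \<omega> * t) * norm (E t x) \<le> M * norm x"
proof -
  assume t: "t \<ge> 0"
  have "norm (E t x) \<le> M * exp (\<omega> * t) * norm x"
    by (meson t bound mult_right_mono norm_blinfun norm_ge_zero order_trans)
  then have "exp (- \<omega> * t) * norm (E t x) \<le> exp (- \<omega> * t) * (M * exp (\<omega> * t) * norm x)"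
    by (intro mult_left_mono) auto
  also have "\<dots> = M * norm x" by (simp add: exp_minus)
  finally show ?thesis .
qed

lemma renorm_le: "renorm x \<le> M * norm x"
  unfolding renorm_def by (rule cSUP_least) (use renorm_term_le in auto)

lemma term_le_renorm: "t \<ge> 0 \<Longrightarrow> exp (- \<omega> * t) * norm (E t x) \<le> renorm x"
  unfolding renorm_def
  by (rule cSUP_upper) (use renorm_term_le in \<open>auto simp: bdd_above_def\<close>)

lemma norm_le_renorm: "norm x \<le> renorm x"
  using term_le_renorm[of 0 x] by (simp add: E_0)

lemma renorm_nonneg: "0 \<le> renorm x"
  by (rule order_trans[OF norm_ge_zero norm_le_renorm])

lemma renorm_triangle: "renorm (x + y) \<le> renorm x + renorm y"
  unfolding renorm_def[of "x + y"]
proof (rule cSUP_least)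
  fix t :: real assume "t \<in> {0..}"
  then have t: "t \<ge> 0" by simp
  have "exp (- \<omega> * t) * norm (E t (x + y)) \<le> exp (- \<omega> * t) * norm (E t x) + exp (- \<omega> * t) * norm (E t y)"
    unfolding blinfun.add_right distrib_left[symmetric] by (intro mult_left_mono norm_triangle_ineq) auto
  also have "\<dots> \<le> renorm x + renorm y" using t by (intro add_mono term_le_renorm)
  finally show "exp (- \<omega> * t) * norm (E t (x + y)) \<le> renorm x + renorm y" .
qed auto

lemma renorm_scaleR: assumes c: "c > 0" shows "renorm (c *\<^sub>R x) = c * renorm x"
proof -
  have le: "renorm (c *\<^sub>R x) \<le> c * renorm x" if "c > 0" for c x
    unfolding renorm_def[of "c *\<^sub>R x"]
  proof (rule cSUP_least)
    fix t :: real assume "t \<in> {0..}"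
    then show "exp (- \<omega> * t) * norm (E t (c *\<^sub>R x)) \<le> c * renorm x"
      using that term_le_renorm[of t x] by (simp add: blinfun.scaleR_right mult.left_commute)
  qed auto
  have "renorm (inverse c *\<^sub>R c *\<^sub>R x) \<le> inverse c * renorm (c *\<^sub>R x)" by (rule le) (use c in simp)
  then show ?thesis using le[of c x] c by (simp add: field_simps)
qed

lemma renorm_E: assumes h: "h \<ge> 0" shows "renorm (E h x) \<le> exp (\<omega> * h) * renorm x"
  unfolding renorm_def[of "E h x"]
proof (rule cSUP_least)
  fix t :: real assume "t \<in> {0..}"
  then have t: "t \<ge> 0" by simp
  have "exp (- \<omega> * t) * norm (E t (E h x)) = exp (\<omega> * h) * (exp (- \<omega> * (t + h)) * norm (E (t + h) x))"
  proof -
    have "exp (- \<omega> * t) = exp (\<omega> * h) * exp (- \<omega> * (t + h))" by (simp add: algebra_simps flip: exp_add)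
    then show ?thesis by (simp only: E_add[OF t h] mult.assoc)
  qed
  also have "\<dots> \<le> exp (\<omega> * h) * renorm x"
    using t h by (intro mult_left_mono term_le_renorm) auto
  finally show "exp (- \<omega> * t) * norm (E t (E h x)) \<le> exp (\<omega> * h) * renorm x" .
qed auto

text \<open>With \<open>z\<close> in the role of \<open>A y\<close>: up to \<open>o(h)\<close>, \<open>(1 + h n) y = e\<^sup>h\<^sup>A y + h (n y - A y)\<close>. Taking \<open>renorm\<close>,
  in which \<open>e\<^sup>h\<^sup>A\<close> has norm at most \<open>e\<^sup>\<omega>\<^sup>h\<close>, dividing by \<open>h\<close> and letting \<open>h\<close> tend to \<open>0\<close> gives the estimate.\<close>

lemma renorm_dissipative:
  assumes y: "((\<lambda>h. (E h y - y) /\<^sub>R h) \<longlongrightarrow> z) (at_right 0)" and n: "n \<ge> 0"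
  shows "(n - \<omega>) * renorm y \<le> renorm (n *\<^sub>R y - z)"
proof -
  let ?d = "\<lambda>h. (E h y - y) /\<^sub>R h" and ?e = "\<lambda>h. (exp (\<omega> * h) - exp (\<omega> * 0)) /\<^sub>R h"
  have e: "(?e \<longlongrightarrow> \<omega>) (at_right 0)"
    by (rule right_quotient_tendsto[where b = 1])
       (auto intro!: derivative_eq_intros simp flip: has_real_derivative_iff_has_vector_derivative)
  have "((\<lambda>h. renorm (n *\<^sub>R y - z) + ?e h * renorm y + M * norm (z - ?d h))
      \<longlongrightarrow> renorm (n *\<^sub>R y - z) + \<omega> * renorm y + M * norm (z - z)) (at_right 0)"
    by (intro tendsto_intros e y)
  moreover have "\<forall>\<^sub>F h in at_right 0. n * renorm y \<le> renorm (n *\<^sub>R y - z) + ?e h * renorm y + M * norm (z - ?d h)"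
    using eventually_at_right_less[of "0::real"]
  proof eventually_elim
    fix h :: real assume h: "h > 0"
    have mult_e: "h * (?e h * c) = (exp (\<omega> * h) - 1) * c" for c using h by simp
    have "h * n \<ge> 0" using h n by simp
    then have "(1 + h * n) * renorm y = renorm ((1 + h * n) *\<^sub>R y)" by (simp add: renorm_scaleR)
    also have "(1 + h * n) *\<^sub>R y = E h y + (h *\<^sub>R (n *\<^sub>R y - z) + h *\<^sub>R (z - ?d h))"
      using h by (simp add: algebra_simps)
    also have "renorm \<dots> \<le> exp (\<omega> * h) * renorm y + (h * renorm (n *\<^sub>R y - z) + h * (M * norm (z - ?d h)))"
    proof (intro order_trans[OF renorm_triangle] add_mono)
      show "renorm (E h y) \<le> exp (\<omega> * h) * renorm y" using h by (intro renorm_E) auto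
      show "renorm (h *\<^sub>R (n *\<^sub>R y - z)) \<le> h * renorm (n *\<^sub>R y - z)" using h by (simp add: renorm_scaleR)
      show "renorm (h *\<^sub>R (z - ?d h)) \<le> h * (M * norm (z - ?d h))"
        unfolding renorm_scaleR[OF h] using h by (intro mult_left_mono renorm_le) auto
    qed
    finally have "h * (n * renorm y) \<le> h * (renorm (n *\<^sub>R y - z) + ?e h * renorm y + M * norm (z - ?d h))"
      using mult_e[of "renorm y"] by (simp only: algebra_simps)
    then show "n * renorm y \<le> renorm (n *\<^sub>R y - z) + ?e h * renorm y + M * norm (z - ?d h)"
      using h by simp
  qed
  ultimately have "n * renorm y \<le> renorm (n *\<^sub>R y - z) + \<omega> * renorm y + M * norm (z - z)"
    by (rule tendsto_lowerbound) simp
  then show ?thesis by (simp add: algebra_simps)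
qed

lemma E_continuous: "continuous_on {0..} (\<lambda>t. E t x)"
  unfolding continuous_on_iff
proof (intro ballI allI impI)
  fix s e :: real assume s: "s \<in> {0..}" and e: "e > 0"
  define C where "C = M * exp (\<bar>\<omega>\<bar> * (s + 1))"
  have C: "C \<ge> 0" using M_nonneg by (simp add: C_def)
  have EC: "norm (E t) \<le> C" if "0 \<le> t" "t \<le> s + 1" for t
  proof -
    have "\<omega> * t \<le> \<bar>\<omega>\<bar> * (s + 1)" using that by (intro mult_mono) auto
    then show ?thesis unfolding C_def using bound[of t] that M_nonneg
      by (meson exp_le_cancel_iff mult_left_mono order_trans)
  qed
  have "((\<lambda>h. C * norm (E h x - x)) \<longlongrightarrow> C * norm (x - x)) (at_right 0)"
    by (intro tendsto_intros E_right)
  then have "\<forall>\<^sub>F h in at_right 0. C * norm (E h x - x) < e"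
    using e by (intro order_tendstoD) auto
  then obtain d where d: "d > 0" "\<And>h. 0 < h \<Longrightarrow> h < d \<Longrightarrow> C * norm (E h x - x) < e"
    by (auto simp: eventually_at_right_field)
  have *: "norm (E b x - E a x) < e" if "0 \<le> a" "a < b" "b - a < d" "a \<le> s + 1" for a b
  proof -
    have "E b x - E a x = E a (E (b - a) x - x)"
      using E_add[of a "b - a" x] that by (simp add: blinfun.diff_right)
    then have "norm (E b x - E a x) \<le> norm (E a) * norm (E (b - a) x - x)" by (simp add: norm_blinfun)
    also have "\<dots> \<le> C * norm (E (b - a) x - x)" using EC that by (intro mult_right_mono) auto
    also have "\<dots> < e" using that by (intro d) auto
    finally show ?thesis .
  qed
  show "\<exists>d>0. \<forall>t\<in>{0..}. dist t s < d \<longrightarrow> dist (E t x) (E s x) < e"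
  proof (intro exI conjI ballI impI)
    show "min d 1 > 0" using d by simp
    fix t assume "t \<in> {0..}" "dist t s < min d 1"
    then show "dist (E t x) (E s x) < e"
      using *[of s t] *[of t s] s e
      by (cases t s rule: linorder_cases) (auto simp: dist_norm norm_minus_commute dist_real_def)
  qed
qed

text \<open>The Laplace transform of the orbit of \<open>x\<close>, cut off at \<open>\<tau>\<close>, solves the resolvent equation up to the boundary term
  at \<open>\<tau>\<close>. The cut-off avoids improper integrals; for \<open>z > \<omega>\<close> and large \<open>\<tau>\<close> the boundary term is a strict contraction of \<open>x\<close>
  and is removed in the lemma \<open>resolvent_surj\<close>.\<close>

lemma truncated_laplace:
  fixes x :: "'h" and z \<tau> :: real
  assumes \<tau>: "\<tau> > 0"
  defines "y \<equiv> integral {0..\<tau>} (\<lambda>s. exp (- z * s) *\<^sub>R E s x)"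
  shows "((\<lambda>h. (E h y - y) /\<^sub>R h) \<longlongrightarrow> z *\<^sub>R y + exp (- z * \<tau>) *\<^sub>R E \<tau> x - x) (at_right 0)"
proof -
  define V where "V s = exp (- z * s) *\<^sub>R E s x" for s
  define \<Phi> where "\<Phi> u = integral {0..u} V" for u
  have contV: "continuous_on {0..b} V" for b
    unfolding V_def by (intro continuous_intros continuous_on_subset[OF E_continuous]) auto
  have der: "(\<Phi> has_vector_derivative V u) (at u within {0..\<tau> + 1})" if "0 \<le> u" "u \<le> \<tau> + 1" for u
    unfolding \<Phi>_def by (rule integral_has_vector_derivative[OF contV]) (use that in auto)
  define f where "f h = exp (z * h) *\<^sub>R (\<Phi> (\<tau> + h) - \<Phi> h)" for h
  \<comment> \<open>the semigroup shifts the window of integration, which makes \<open>h \<mapsto> E h y\<close> differentiable at \<open>0\<close>\<close>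
  have f: "E h y = f h" if h: "h \<ge> 0" for h
  proof -
    have "exp (- z * h) *\<^sub>R E h y = integral {0..\<tau>} (\<lambda>s. exp (- z * h) *\<^sub>R E h (V s))"
      unfolding y_def V_def[symmetric]
      by (simp add: integral_blinfun_apply integrable_continuous_real[OF contV])
    also have "\<dots> = integral {0..\<tau>} (V \<circ> (+) h)"
    proof (rule integral_cong)
      fix s assume "s \<in> {0..\<tau>}"
      then have "E (h + s) x = E h (E s x)" using h by (intro E_add) auto
      then show "exp (- z * h) *\<^sub>R E h (V s) = (V \<circ> (+) h) s"
        by (simp add: V_def blinfun.scaleR_right algebra_simps flip: exp_add)
    qed
    also have "\<dots> = integral {h..\<tau> + h} V" by (simp add: integral_shift_Icc_real)
    also have "\<dots> = \<Phi> (\<tau> + h) - \<Phi> h"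
      using Henstock_Kurzweil_Integration.integral_combine[of 0 h "\<tau> + h" V] h \<tau>
      by (simp add: \<Phi>_def integrable_continuous_real[OF contV] eq_diff_eq add.commute)
    finally have "exp (z * h) *\<^sub>R exp (- z * h) *\<^sub>R E h y = f h" by (simp only: f_def)
    then show ?thesis by (simp flip: exp_add)
  qed
  have sub: "(\<lambda>h. \<tau> + h) ` {0..1} \<subseteq> {0..\<tau> + 1}" "{0..1} \<subseteq> {0..\<tau> + 1}" using \<tau> by auto
  have d1: "((\<lambda>h. \<Phi> (\<tau> + h)) has_vector_derivative V \<tau>) (at 0 within {0..1})"
  proof -
    have "((\<lambda>h. \<tau> + h) has_vector_derivative 1) (at 0 within {0..1})"
      by (auto intro!: derivative_eq_intros)
    moreover have "(\<Phi> has_vector_derivative V \<tau>) (at (\<tau> + 0) within (\<lambda>h. \<tau> + h) ` {0..1})"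
      using \<tau> by (intro has_vector_derivative_within_subset[OF _ sub(1)]) (auto intro!: der)
    ultimately have "((\<Phi> \<circ> (\<lambda>h. \<tau> + h)) has_vector_derivative 1 *\<^sub>R V \<tau>) (at 0 within {0..1})"
      by (rule vector_diff_chain_within)
    then show ?thesis by (simp add: comp_def)
  qed
  have d2: "(\<Phi> has_vector_derivative V 0) (at 0 within {0..1})"
    using \<tau> by (intro has_vector_derivative_within_subset[OF der sub(2)]) auto
  have d3: "((\<lambda>h. exp (z * h)) has_real_derivative z) (at 0 within {0..1})"
    by (auto intro!: derivative_eq_intros)
  have "(f has_vector_derivative exp (z * 0) *\<^sub>R (V \<tau> - V 0) + z *\<^sub>R (\<Phi> (\<tau> + 0) - \<Phi> 0)) (at 0 within {0..1})"
    unfolding f_def by (rule has_vector_derivative_scaleR[OF d3 has_vector_derivative_diff[OF d1 d2]])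
  moreover have "V 0 = x" "V \<tau> = exp (- z * \<tau>) *\<^sub>R E \<tau> x" by (simp_all add: V_def E_0)
  moreover have "\<Phi> \<tau> = y" "\<Phi> 0 = 0" by (simp_all add: \<Phi>_def V_def[abs_def] y_def)
  ultimately have "(f has_vector_derivative z *\<^sub>R y + exp (- z * \<tau>) *\<^sub>R E \<tau> x - x) (at 0 within {0..1})"
    by (simp add: algebra_simps)
  from right_quotient_tendsto[OF this]
  have "((\<lambda>h. (f h - f 0) /\<^sub>R h) \<longlongrightarrow> z *\<^sub>R y + exp (- z * \<tau>) *\<^sub>R E \<tau> x - x) (at_right 0)"
    by simp
  then show ?thesis
  proof (rule Lim_transform_eventually)
    show "\<forall>\<^sub>F h in at_right 0. (f h - f 0) /\<^sub>R h = (E h y - y) /\<^sub>R h"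
      using eventually_at_right_less[of "0::real"]
    proof eventually_elim
      fix h :: real assume "h > 0"
      then show "(f h - f 0) /\<^sub>R h = (E h y - y) /\<^sub>R h" using f[of h] f[of 0] by (simp add: E_0)
    qed
  qed
qed

text \<open>For \<open>K = exp (- z * \<tau>) *\<^sub>R E \<tau>\<close> of norm at most \<open>1/2\<close>, the equation \<open>x - K x = w\<close> has a solution \<open>x\<close>, and
  \<open>z - A\<close> maps the truncated Laplace transform of \<open>x\<close> to \<open>w\<close>.\<close>

lemma resolvent_surj:
  assumes z: "z > \<omega>"
  shows "\<exists>y v. ((\<lambda>h. (E h y - y) /\<^sub>R h) \<longlongrightarrow> v) (at_right 0) \<and> z *\<^sub>R y - v = w"
proof -
  define \<tau> where "\<tau> = max 1 (ln (2 * M + 1) / (z - \<omega>))"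
  have \<tau>: "\<tau> > 0" by (simp add: \<tau>_def)
  define K where "K = exp (- z * \<tau>) *\<^sub>R E \<tau>"
  have "ln (2 * M + 1) \<le> \<tau> * (z - \<omega>)" using z by (simp add: \<tau>_def max_def field_simps split: if_splits)
  then have "exp (ln (2 * M + 1)) \<le> exp (\<tau> * (z - \<omega>))" by simp
  then have "2 * M + 1 \<le> exp (\<tau> * (z - \<omega>))" using M_nonneg by simp
  then have "M * exp ((\<omega> - z) * \<tau>) \<le> 1 / 2"
  proof -
    have "exp ((\<omega> - z) * \<tau>) * exp (\<tau> * (z - \<omega>)) = 1" by (simp add: algebra_simps flip: exp_add)
    moreover have "2 * M * exp ((\<omega> - z) * \<tau>) \<le> exp (\<tau> * (z - \<omega>)) * exp ((\<omega> - z) * \<tau>)"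
      using \<open>2 * M + 1 \<le> _\<close> by (intro mult_right_mono) auto
    ultimately show ?thesis by (simp add: mult.commute)
  qed
  moreover have "norm K \<le> M * exp ((\<omega> - z) * \<tau>)"
  proof -
    have "norm K \<le> exp (- z * \<tau>) * (M * exp (\<omega> * \<tau>))"
      unfolding K_def norm_scaleR using bound[of \<tau>] \<tau> by (simp add: mult_left_mono)
    also have "\<dots> = M * exp ((\<omega> - z) * \<tau>)" by (simp add: algebra_simps exp_diff exp_minus field_simps)
    finally show ?thesis .
  qed
  ultimately have K: "norm K \<le> 1 / 2" by simp
  have "\<exists>!x. w + K x = x"
  proof (rule banach_fix_type[of "1/2"])
    show "\<forall>a b. dist (w + K a) (w + K b) \<le> 1 / 2 * dist a b"
    proof (intro allI)
      fix a b
      have "norm (K (a - b)) \<le> 1 / 2 * norm (a - b)"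
        by (meson K mult_right_mono norm_blinfun norm_ge_zero order_trans)
      then show "dist (w + K a) (w + K b) \<le> 1 / 2 * dist a b" by (simp add: dist_norm blinfun.diff_right)
    qed
  qed auto
  then obtain x where x: "w + K x = x" by blast
  define y where "y = integral {0..\<tau>} (\<lambda>s. exp (- z * s) *\<^sub>R E s x)"
  have "((\<lambda>h. (E h y - y) /\<^sub>R h) \<longlongrightarrow> z *\<^sub>R y + K x - x) (at_right 0)"
    using truncated_laplace[OF \<tau>, of z x] by (simp add: y_def K_def blinfun.scaleR_left)
  moreover have "z *\<^sub>R y - (z *\<^sub>R y + K x - x) = w"
    using arg_cong[OF x, of "\<lambda>u. u - K x"] by simp
  ultimately show ?thesis by blast
qed

text \<open>Dissipativity makes \<open>z - A\<close> injective on \<open>D\<close> with bounded inverse. Bijectivity matters already for the meaning of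
  \<open>resolvent_op\<close>, which applies \<open>Blinfun\<close> to a function that has to be bounded and linear.\<close>

lemma renorm_resolvent_op_le:
  assumes D: "closed_densely_defined D A" and gen: "is_generator D A E"
    and z: "z > \<omega>" "z \<ge> 0"
  shows "(z - \<omega>) * renorm (resolvent_op D A z w) \<le> renorm w"
proof -
  define F where "F x = z *\<^sub>R x - A x" for x
  have A: "((\<lambda>t. (E t x - x) /\<^sub>R t) \<longlongrightarrow> A x) (at_right 0)" if "x \<in> D" for x
    using gen that by (auto simp: is_generator_def)
  have dis: "(z - \<omega>) * renorm x \<le> renorm (F x)" if "x \<in> D" for x
    unfolding F_def by (rule renorm_dissipative[OF A[OF that] z(2)])
  have D_sub: "subspace D" using D by (simp add: closed_densely_defined_def)
  have A_add: "A (x + y) = A x + A y" and A_scale: "A (c *\<^sub>R x) = c *\<^sub>R A x" if "x \<in> D" "y \<in> D" for x y c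
    using D that by (auto simp: closed_densely_defined_def)
  have F_add: "F (x + y) = F x + F y" and F_scale: "F (c *\<^sub>R x) = c *\<^sub>R F x" if "x \<in> D" "y \<in> D" for x y c
    using that by (auto simp: F_def A_add A_scale algebra_simps)
  have surj: "\<exists>y\<in>D. F y = w" for w
  proof -
    obtain y v where y: "((\<lambda>h. (E h y - y) /\<^sub>R h) \<longlongrightarrow> v) (at_right 0)" "z *\<^sub>R y - v = w"
      using resolvent_surj[OF z(1)] by blast
    have "y \<in> D" using gen y(1) by (auto simp: is_generator_def)
    moreover have "A y = v" using tendsto_unique[OF _ A[OF \<open>y \<in> D\<close>] y(1)] by simp
    ultimately show ?thesis using y by (auto simp: F_def)
  qed
  have renorm_0: "renorm 0 = 0" using renorm_le[of 0] renorm_nonneg[of 0] by simp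
  have inj: "x = y" if "x \<in> D" "y \<in> D" "F x = F y" for x y
  proof -
    have my: "(-1) *\<^sub>R y \<in> D" using D_sub that subspace_scale by blast
    then have "x - y \<in> D" using D_sub that by (simp add: subspace_diff)
    moreover have "F (x - y) = 0"
      using F_add[OF that(1) my] F_scale[OF that(2,2), of "-1"] that(3) by simp
    ultimately have "(z - \<omega>) * renorm (x - y) \<le> 0" using dis[of "x - y"] renorm_0 by simp
    then have "renorm (x - y) \<le> 0" using z by (simp add: mult_le_0_iff)
    then have "norm (x - y) \<le> 0" using norm_le_renorm order_trans by blast
    then show ?thesis by simp
  qed
  define G where "G = inv_into D F"
  have GD: "G w \<in> D" and FG: "F (G w) = w" for w
    using surj[of w] unfolding G_def by (metis imageI inv_into_into, metis f_inv_into_f imageI)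
  have Gbd: "(z - \<omega>) * renorm (G w) \<le> renorm w" for w using dis[OF GD, of w] by (simp add: FG)
  have "bounded_linear G"
  proof (rule bounded_linear_intro)
    show "G (x + y) = G x + G y" for x y
      by (rule inj) (auto simp: GD FG F_add subspace_add[OF D_sub])
    show "G (c *\<^sub>R x) = c *\<^sub>R G x" for c x
      by (rule inj) (auto simp: GD FG F_scale[OF GD GD] subspace_scale[OF D_sub])
    show "norm (G x) \<le> norm x * (M / (z - \<omega>))" for x
    proof -
      have "(z - \<omega>) * norm (G x) \<le> (z - \<omega>) * renorm (G x)"
        using z by (intro mult_left_mono norm_le_renorm) auto
      also have "\<dots> \<le> M * norm x" using Gbd[of x] renorm_le[of x] by simp
      finally show ?thesis using z by (simp add: field_simps)
    qed
  qed
  then have "blinfun_apply (resolvent_op D A z) = G"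
    unfolding resolvent_op_def G_def F_def[abs_def] by (rule bounded_linear_Blinfun_apply)
  then show ?thesis using Gbd[of w] by simp
qed

lemma renorm_yosida:
  assumes "closed_densely_defined D A" and "is_generator D A E" and n: "real n > \<omega>" "n \<ge> 1"
  shows "renorm (yosida D A n x + real n *\<^sub>R x) \<le> (real n)\<^sup>2 / (real n - \<omega>) * renorm x"
proof -
  have "yosida D A n x + real n *\<^sub>R x = (real n)\<^sup>2 *\<^sub>R resolvent_op D A (real n) x"
    by (simp add: yosida_def blinfun.bilinear_simps)
  also have "renorm \<dots> = (real n)\<^sup>2 * renorm (resolvent_op D A (real n) x)"
    by (rule renorm_scaleR) (use n in simp)
  also have "\<dots> \<le> (real n)\<^sup>2 * (renorm x / (real n - \<omega>))"
    using renorm_resolvent_op_le[OF assms(1,2) n(1), of x] n by (intro mult_left_mono) (auto simp: field_simps)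
  finally show ?thesis by simp
qed

end

text \<open>Since \<open>n\<^sup>2 / (n - \<omega>) = n + \<omega> + \<omega>\<^sup>2 / (n - \<omega>)\<close>, the bound is uniform as soon as \<open>n - \<omega>\<close> stays away from \<open>0\<close>, which
  it does because \<open>n\<close> is an integer.\<close>

lemma yosida_growth_bound:
  fixes \<omega> :: real
  shows "\<exists>c\<ge>0. \<forall>n::nat. real n > \<omega> \<longrightarrow> (real n)\<^sup>2 / (real n - \<omega>) \<le> real n + c"
proof -
  define \<delta> where "\<delta> = of_int (\<lfloor>\<omega>\<rfloor> + 1) - \<omega>"
  have \<delta>: "\<delta> > 0" unfolding \<delta>_def by linarith
  have "(real n)\<^sup>2 / (real n - \<omega>) \<le> real n + (\<bar>\<omega>\<bar> + \<omega>\<^sup>2 / \<delta>)" if n: "real n > \<omega>" for n :: nat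
  proof -
    have "\<lfloor>\<omega>\<rfloor> + 1 \<le> int n" using n by linarith
    then have "\<delta> \<le> real n - \<omega>" unfolding \<delta>_def by linarith
    then have "\<omega>\<^sup>2 / (real n - \<omega>) \<le> \<omega>\<^sup>2 / \<delta>" using \<delta> by (intro divide_left_mono) auto
    moreover have "(real n)\<^sup>2 / (real n - \<omega>) = real n + \<omega> + \<omega>\<^sup>2 / (real n - \<omega>)"
      using n by (simp add: field_simps power2_eq_square)
    ultimately show ?thesis by linarith
  qed
  moreover have "\<bar>\<omega>\<bar> + \<omega>\<^sup>2 / \<delta> \<ge> 0" using \<delta> by simp
  ultimately show ?thesis by blast
qed

section \<open>Evolution equations with strongly continuous right-hand sides\<close>

lemma norm_increment_le:
  fixes f :: "real \<Rightarrow> 'a::real_normed_vector" and \<phi> :: "real \<Rightarrow> real"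
  assumes f: "\<And>s. s \<in> {0..b} \<Longrightarrow> (f has_vector_derivative f' s) (at s within {0..b})"
    and \<phi>: "\<And>s. s \<in> {0..b} \<Longrightarrow> (\<phi> has_vector_derivative \<phi>' s) (at s within {0..b})"
    and le: "\<And>s. s \<in> {0..b} \<Longrightarrow> norm (f' s) \<le> \<phi>' s"
    and ac: "0 \<le> a" "a \<le> c" "c \<le> b"
  shows "norm (f c - f a) \<le> \<phi> c - \<phi> a"
proof (cases "a = c")
  case False
  have cont: "continuous_on {a..c} g"
    if "\<And>s. s \<in> {0..b} \<Longrightarrow> (g has_vector_derivative g' s) (at s within {0..b})"
    for g :: "real \<Rightarrow> 'c::real_normed_vector" and g'
  proof -
    have "continuous_on {0..b} g"
      using that has_vector_derivative_continuous by (blast intro: continuous_on_eq_continuous_within[THEN iffD2])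
    then show ?thesis by (rule continuous_on_subset) (use ac in auto)
  qed
  have at: "at s within {0..b} = at s" if "a < s" "s < c" for s
    using that ac by (intro at_within_Icc_at) auto
  show ?thesis
  proof (rule differentiable_bound_general)
    show "a < c" using False ac by simp
    show "continuous_on {a..c} f" by (rule cont[OF f])
    show "continuous_on {a..c} \<phi>" by (rule cont[OF \<phi>])
    fix s assume s: "a < s" "s < c"
    then have "s \<in> {0..b}" using ac by simp
    then show "(f has_vector_derivative f' s) (at s)" "(\<phi> has_vector_derivative \<phi>' s) (at s)" "norm (f' s) \<le> \<phi>' s"
      using f \<phi> le at[OF s] by (metis, metis, blast)
  qed
qed simp

lemma strongly_continuous_bounded:
  fixes f :: "real \<Rightarrow> 'a::banach \<Rightarrow>\<^sub>L 'b::real_normed_vector"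
  assumes "compact S" "\<And>x. continuous_on S (\<lambda>s. f s x)"
  shows "bounded (f ` S)"
proof (rule uniform_boundedness)
  show "bounded ((\<lambda>g. blinfun_apply g x) ` f ` S)" for x
    using compact_imp_bounded[OF compact_continuous_image[OF assms(2,1)]] by (simp add: image_image)
qed

text \<open>Strong continuity suffices here because the family is bounded: \<open>F s (g s - g a)\<close> is controlled by the bound and
  \<open>F s (g a)\<close> by strong continuity at the fixed vector \<open>g a\<close>.\<close>

lemma continuous_on_strong_apply:
  fixes F :: "real \<Rightarrow> 'a::real_normed_vector \<Rightarrow>\<^sub>L 'b::real_normed_vector"
  assumes bd: "\<And>s. s \<in> S \<Longrightarrow> norm (F s) \<le> C"
    and F: "\<And>x. continuous_on S (\<lambda>s. F s x)" and g: "continuous_on S g"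
  shows "continuous_on S (\<lambda>s. F s (g s))"
  unfolding continuous_on_def
proof
  fix a assume a: "a \<in> S"
  have "((\<lambda>s. C * norm (g s - g a)) \<longlongrightarrow> C * norm (g a - g a)) (at a within S)"
    by (intro tendsto_intros) (use a g in \<open>auto simp: continuous_on_def\<close>)
  then have "((\<lambda>s. F s (g s - g a)) \<longlongrightarrow> 0) (at a within S)"
  proof (rule Lim_null_comparison[rotated, OF tendsto_eq_rhs])
    show "\<forall>\<^sub>F s in at a within S. norm (F s (g s - g a)) \<le> C * norm (g s - g a)"
      unfolding eventually_at_filter
      by (intro always_eventually) (meson bd mult_right_mono norm_blinfun norm_ge_zero order_trans)
  qed simp
  moreover have "((\<lambda>s. F s (g a)) \<longlongrightarrow> F a (g a)) (at a within S)"
    using F[of "g a"] a by (simp add: continuous_on_def)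
  ultimately have "((\<lambda>s. F s (g s - g a) + F s (g a)) \<longlongrightarrow> 0 + F a (g a)) (at a within S)"
    by (rule tendsto_add)
  then show "((\<lambda>s. F s (g s)) \<longlongrightarrow> F a (g a)) (at a within S)" by (simp add: blinfun.diff_right)
qed

text \<open>A strongly continuous operator function need not be integrable in the operator norm, so its integral is taken pointwise.\<close>

definition strong_integral :: "(real \<Rightarrow> 'a::real_normed_vector \<Rightarrow>\<^sub>L 'b::banach) \<Rightarrow> real \<Rightarrow> 'a \<Rightarrow>\<^sub>L 'b" where
  "strong_integral g t = Blinfun (\<lambda>x. integral {0..t} (\<lambda>s. g s x))"

lemma
  assumes cont: "\<And>x. continuous_on {0..b} (\<lambda>s. blinfun_apply (g s) x)"
    and C: "\<And>s. s \<in> {0..b} \<Longrightarrow> norm (g s) \<le> C"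
  shows strong_integral_0: "0 \<le> b \<Longrightarrow> strong_integral g 0 = 0"
    and strong_integral_has_vector_derivative:
      "t \<in> {0..b} \<Longrightarrow> ((\<lambda>s. strong_integral g s x) has_vector_derivative g t x) (at t within {0..b})"
    and norm_strong_integral_diff_le: "0 \<le> s \<Longrightarrow> s \<le> t \<Longrightarrow> t \<le> b \<Longrightarrow>
      norm (strong_integral g t - strong_integral g s) \<le> C * (t - s)"
proof -
  have cont': "continuous_on {0..t} (\<lambda>s. g s x)" if "t \<in> {0..b}" for t x
    using that by (intro continuous_on_subset[OF cont]) auto
  have ap: "strong_integral g t x = integral {0..t} (\<lambda>s. g s x)" if t: "t \<in> {0..b}" for t x
  proof -
    have "bounded_linear (\<lambda>x. integral {0..t} (\<lambda>s. g s x))"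
    proof (rule bounded_linear_intro)
      fix x y :: 'a and c :: real
      note int = integrable_continuous_real[OF cont'[OF t]]
      show "integral {0..t} (\<lambda>s. g s (x + y)) = integral {0..t} (\<lambda>s. g s x) + integral {0..t} (\<lambda>s. g s y)"
        by (simp add: blinfun.add_right integral_add[OF int int])
      show "integral {0..t} (\<lambda>s. g s (c *\<^sub>R x)) = c *\<^sub>R integral {0..t} (\<lambda>s. g s x)"
        by (simp add: blinfun.scaleR_right)
      show "norm (integral {0..t} (\<lambda>s. g s x)) \<le> norm x * (C * t)"
      proof -
        have "norm (integral {0..t} (\<lambda>s. g s x)) \<le> (C * norm x) * (t - 0)"
          using t C by (intro integral_bound cont')
            (auto intro!: order_trans[OF norm_blinfun] mult_right_mono)
        then show ?thesis by (simp add: mult_ac)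
      qed
    qed
    then show ?thesis unfolding strong_integral_def by (simp add: bounded_linear_Blinfun_apply)
  qed
  show "0 \<le> b \<Longrightarrow> strong_integral g 0 = 0" by (rule blinfun_eqI) (simp add: ap)
  have der: "((\<lambda>s. strong_integral g s x) has_vector_derivative g t x) (at t within {0..b})"
    if t: "t \<in> {0..b}" for t x
    by (rule has_vector_derivative_transform[OF t _ integral_has_vector_derivative[OF cont t]]) (simp add: ap)
  then show "t \<in> {0..b} \<Longrightarrow> ((\<lambda>s. strong_integral g s x) has_vector_derivative g t x) (at t within {0..b})" .
  show "norm (strong_integral g t - strong_integral g s) \<le> C * (t - s)" if st: "0 \<le> s" "s \<le> t" "t \<le> b"
  proof (rule norm_blinfun_bound)
    have "0 \<le> C" using C[of t] st norm_ge_zero[of "g t"] by (auto simp del: norm_ge_zero)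
    then show "0 \<le> C * (t - s)" using st by simp
    fix x
    have "norm (strong_integral g t x - strong_integral g s x) \<le> C * norm x * t - C * norm x * s"
    proof (rule norm_increment_le[OF der _ _ st])
      show "((\<lambda>r. C * norm x * r) has_vector_derivative C * norm x) (at r within {0..b})" for r
        by (auto intro!: derivative_eq_intros simp flip: has_real_derivative_iff_has_vector_derivative)
      show "norm (g r x) \<le> C * norm x" if "r \<in> {0..b}" for r
        using C[OF that] by (meson mult_right_mono norm_blinfun norm_ge_zero order_trans)
    qed
    then show "norm ((strong_integral g t - strong_integral g s) x) \<le> C * (t - s) * norm x"
      by (simp add: blinfun.diff_left algebra_simps)
  qed
qed

text \<open>The ball of radius \<open>r\<close> for the norm on bilinear forms that is dual to \<open>p\<close>. Balls of the operator norm need not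
  be preserved by the flow on a time interval that is independent of the Yosida index.\<close>

definition form_ball :: "('h::real_inner \<Rightarrow> real) \<Rightarrow> real \<Rightarrow> ('h \<Rightarrow>\<^sub>L 'h) set" where
  "form_ball p r = {u. \<forall>x y. \<bar>blinfun_apply u x \<bullet> y\<bar> \<le> r * (p x * p y)}"

lemma closed_form_ball: "closed (form_ball p r)"
proof -
  have "form_ball p r = (\<Inter>x. \<Inter>y. {u. \<bar>blinfun_apply u x \<bullet> y\<bar> \<le> r * (p x * p y)})"
    by (auto simp: form_ball_def)
  then show ?thesis by (auto intro!: closed_INT closed_Collect_le continuous_intros)
qed

text \<open>Picard iteration in the set of continuous curves that stay in the moving balls of radius \<open>\<rho> t\<close>; the hypothesis on
  \<open>\<rho>'\<close> ensures that the integral operator does not leave this set. The weight \<open>exp (- 2 l t)\<close> makes the iteration a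
  contraction with factor \<open>1/2\<close> however large the Lipschitz constant \<open>l\<close> is, so that the length \<open>b\<close> of the interval is not
  restricted by \<open>l\<close>. Although \<open>f\<close> is only strongly continuous in time, the solution is Lipschitz in the operator norm,
  which allows the iteration to take place in the space of bounded continuous functions with values in operators.\<close>

lemma strong_picard_in_form_balls:
  fixes f :: "real \<Rightarrow> ('h::{real_inner, banach} \<Rightarrow>\<^sub>L 'h) \<Rightarrow> 'h \<Rightarrow>\<^sub>L 'h" and p :: "'h \<Rightarrow> real"
  assumes b: "0 \<le> b" and l: "0 < l" and p: "\<And>x. 0 \<le> p x"
    and cont: "\<And>w x. continuous_on {0..b} w \<Longrightarrow> (\<And>t. t \<in> {0..b} \<Longrightarrow> w t \<in> form_ball p (\<rho> t))
        \<Longrightarrow> continuous_on {0..b} (\<lambda>s. f s (w s) x)"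
    and C: "\<And>s u. s \<in> {0..b} \<Longrightarrow> u \<in> form_ball p (\<rho> s) \<Longrightarrow> norm (f s u) \<le> C"
    and lip: "\<And>s u v. s \<in> {0..b} \<Longrightarrow> u \<in> form_ball p (\<rho> s) \<Longrightarrow> v \<in> form_ball p (\<rho> s)
        \<Longrightarrow> norm (f s u - f s v) \<le> l * norm (u - v)"
    and inv: "\<And>s u. s \<in> {0..b} \<Longrightarrow> u \<in> form_ball p (\<rho> s) \<Longrightarrow> f s u \<in> form_ball p (\<rho>' s)"
    and init: "u0 \<in> form_ball p (\<rho> 0)"
    and \<rho>: "\<And>s. s \<in> {0..b} \<Longrightarrow> (\<rho> has_vector_derivative \<rho>' s) (at s within {0..b})"
    and \<rho>_nonneg: "\<And>s. s \<in> {0..b} \<Longrightarrow> 0 \<le> \<rho> s"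
  shows "\<exists>w. continuous_on {0..b} w \<and> w 0 = u0 \<and> (\<forall>t\<in>{0..b}. w t \<in> form_ball p (\<rho> t) \<and>
           (\<forall>x. ((\<lambda>s. w s x) has_vector_derivative f t (w t) x) (at t within {0..b})))"
proof -
  \<comment> \<open>bounded continuous functions live on all of \<open>\<real>\<close>; curves on \<open>{0..b}\<close> are extended as constants\<close>
  define c where "c t = max 0 (min b t)" for t
  have c: "c t \<in> {0..b}" "t \<in> {0..b} \<Longrightarrow> c t = t" for t using b by (auto simp: c_def)
  have c_cont: "continuous_on UNIV c" unfolding c_def by (intro continuous_intros)
  define S where "S = PiC UNIV (\<lambda>t. (\<lambda>v. exp (2 * l * c t) *\<^sub>R v) -` form_ball p (\<rho> (c t)))"
  define w where "w v t = exp (2 * l * t) *\<^sub>R apply_bcontfun v t" for v :: "real \<Rightarrow>\<^sub>C ('h \<Rightarrow>\<^sub>L 'h)" and t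
  define J where "J v = strong_integral (\<lambda>s. f s (w v s))" for v
  define \<Psi> where "\<Psi> v t = exp (- (2 * l * c t)) *\<^sub>R (u0 + J v (c t))" for v t
  have "complete S"
    unfolding S_def complete_eq_closed
    by (intro closed_PiC closed_vimage closed_form_ball continuous_intros)
  have "0 \<in> S"
    using p \<rho>_nonneg[OF c(1)] by (auto simp: S_def mem_PiC_iff form_ball_def)
  have w_cont: "continuous_on {0..b} (w v)" for v
    unfolding w_def by (intro continuous_intros) simp
  have w_in: "w v t \<in> form_ball p (\<rho> t)" if v: "v \<in> S" and t: "t \<in> {0..b}" for v t
  proof -
    have "exp (2 * l * c t) *\<^sub>R v t \<in> form_ball p (\<rho> (c t))"
      using v by (simp add: S_def mem_PiC_iff Pi_iff)
    then show ?thesis by (simp add: w_def c(2)[OF t])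
  qed
  have f_cont: "continuous_on {0..b} (\<lambda>s. f s (w v s) x)" if "v \<in> S" for v x
    by (rule cont[OF w_cont w_in[OF that]])
  have f_C: "norm (f s (w v s)) \<le> C" if "v \<in> S" "s \<in> {0..b}" for v s
    by (rule C[OF that(2) w_in[OF that]])
  have J_0: "J v 0 = 0" if "v \<in> S" for v
    unfolding J_def by (rule strong_integral_0[OF f_cont[OF that] f_C[OF that] b])
  have J_der: "((\<lambda>s. J v s x) has_vector_derivative f t (w v t) x) (at t within {0..b})"
    if "v \<in> S" "t \<in> {0..b}" for v t x
    unfolding J_def by (rule strong_integral_has_vector_derivative[OF f_cont[OF that(1)] f_C[OF that(1)] that(2)])
  have J_lip: "norm (J v t - J v s) \<le> C * (t - s)" if "v \<in> S" "0 \<le> s" "s \<le> t" "t \<le> b" for v s t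
    unfolding J_def by (rule norm_strong_integral_diff_le[OF f_cont[OF that(1)] f_C[OF that(1)] that(2-4)])
  have C_nonneg: "0 \<le> C" using order_trans[OF norm_ge_zero f_C[OF \<open>0 \<in> S\<close>, of 0]] b by simp
  have J_cont: "continuous_on {0..b} (J v)" if v: "v \<in> S" for v
  proof (rule lipschitz_on_continuous_on[OF lipschitz_onI])
    fix s t assume "s \<in> {0..b}" "t \<in> {0..b}"
    then show "dist (J v s) (J v t) \<le> C * dist s t"
      using J_lip[OF v, of s t] J_lip[OF v, of t s]
      by (cases "s \<le> t") (auto simp: dist_norm norm_minus_commute)
  qed (rule C_nonneg)
  have \<Psi>_bcont: "\<Psi> v \<in> bcontfun" if v: "v \<in> S" for v
  proof (rule bcontfun_normI)
    show "continuous_on UNIV (\<Psi> v)" unfolding \<Psi>_def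
      by (intro continuous_intros continuous_on_compose2[OF J_cont[OF v] c_cont] c_cont) (use c in auto)
    fix t
    have ct: "0 \<le> c t" "c t \<le> b" using c(1)[of t] by auto
    have "norm (J v (c t)) \<le> C * c t" using J_lip[OF v order_refl ct] J_0[OF v] by simp
    also have "\<dots> \<le> C * b" using ct C_nonneg by (intro mult_left_mono)
    finally have "norm (u0 + J v (c t)) \<le> norm u0 + C * b"
      by (intro order_trans[OF norm_triangle_ineq]) simp
    moreover have "exp (- (2 * l * c t)) \<le> 1" using ct l by simp
    ultimately have "exp (- (2 * l * c t)) * norm (u0 + J v (c t)) \<le> 1 * (norm u0 + C * b)"
      by (intro mult_mono) auto
    then show "norm (\<Psi> v t) \<le> norm u0 + C * b" by (simp add: \<Psi>_def)
  qed
  have "\<exists>!v\<in>S. Bcontfun (\<Psi> v) = v"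
  proof (rule Banach_fix[of S "1/2"])
    show "complete S" "S \<noteq> {}" using \<open>complete S\<close> \<open>0 \<in> S\<close> by auto
    show "(\<lambda>v. Bcontfun (\<Psi> v)) ` S \<subseteq> S"
    proof (rule image_subsetI)
      fix v assume v: "v \<in> S"
      have "u0 + J v t \<in> form_ball p (\<rho> t)" if t: "t \<in> {0..b}" for t
        unfolding form_ball_def
      proof (safe)
        fix x y
        have "norm (J v t x \<bullet> y - J v 0 x \<bullet> y) \<le> \<rho> t * (p x * p y) - \<rho> 0 * (p x * p y)"
        proof (rule norm_increment_le[of b])
          show "((\<lambda>s. J v s x \<bullet> y) has_vector_derivative f s (w v s) x \<bullet> y) (at s within {0..b})"
            if "s \<in> {0..b}" for s
            by (rule bounded_linear.has_vector_derivative[OF bounded_linear_inner_left J_der[OF v that]])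
          show "((\<lambda>s. \<rho> s * (p x * p y)) has_vector_derivative \<rho>' s * (p x * p y)) (at s within {0..b})"
            if "s \<in> {0..b}" for s
            by (rule bounded_linear.has_vector_derivative[OF bounded_linear_mult_left \<rho>[OF that]])
          show "norm (f s (w v s) x \<bullet> y) \<le> \<rho>' s * (p x * p y)" if "s \<in> {0..b}" for s
            using inv[OF that w_in[OF v that]] by (simp add: form_ball_def)
        qed (use t in auto)
        moreover have "\<bar>u0 x \<bullet> y\<bar> \<le> \<rho> 0 * (p x * p y)" using init by (simp add: form_ball_def)
        ultimately show "\<bar>blinfun_apply (u0 + J v t) x \<bullet> y\<bar> \<le> \<rho> t * (p x * p y)"
          by (simp add: J_0[OF v] blinfun.add_left inner_add_left)
      qed
      then show "Bcontfun (\<Psi> v) \<in> S"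
        using c(1) by (simp add: S_def mem_PiC_iff Bcontfun_inverse[OF \<Psi>_bcont[OF v]] \<Psi>_def flip: exp_add)
    qed
    fix v v' assume v: "v \<in> S" and v': "v' \<in> S"
    show "dist (Bcontfun (\<Psi> v)) (Bcontfun (\<Psi> v')) \<le> 1 / 2 * dist v v'"
    proof (rule dist_bound)
      fix t
      let ?d = "dist v v'"
      have ct: "0 \<le> c t" "c t \<le> b" using c(1)[of t] by auto
      have "norm (J v (c t) - J v' (c t)) \<le> exp (2 * l * c t) * (?d / 2)"
      proof (rule norm_blinfun_bound)
        fix x
        have "norm ((J v (c t) x - J v' (c t) x) - (J v 0 x - J v' 0 x))
            \<le> exp (2 * l * c t) * (?d / 2 * norm x) - exp (2 * l * 0) * (?d / 2 * norm x)"
        proof (rule norm_increment_le[OF _ _ _ order_refl ct])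
          fix s assume s: "s \<in> {0..b}"
          show "((\<lambda>s. J v s x - J v' s x) has_vector_derivative f s (w v s) x - f s (w v' s) x) (at s within {0..b})"
            by (intro has_vector_derivative_diff J_der v v' s)
          show "((\<lambda>s. exp (2 * l * s) * (?d / 2 * norm x)) has_vector_derivative
              exp (2 * l * s) * (2 * l) * (?d / 2 * norm x)) (at s within {0..b})"
            unfolding has_real_derivative_iff_has_vector_derivative[symmetric]
            by (auto intro!: derivative_eq_intros)
          have "norm (w v s - w v' s) = exp (2 * l * s) * dist (v s) (v' s)"
            by (simp add: w_def dist_norm flip: scaleR_diff_right)
          also have "\<dots> \<le> exp (2 * l * s) * ?d" by (intro mult_left_mono dist_bounded) auto
          finally have "l * norm (w v s - w v' s) \<le> l * (exp (2 * l * s) * ?d)" using l by simp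
          then have "norm (f s (w v s) - f s (w v' s)) \<le> l * (exp (2 * l * s) * ?d)"
            by (rule order_trans[OF lip[OF s w_in[OF v s] w_in[OF v' s]]])
          then have "norm ((f s (w v s) - f s (w v' s)) x) \<le> l * (exp (2 * l * s) * ?d) * norm x"
            by (meson mult_right_mono norm_blinfun norm_ge_zero order_trans)
          then show "norm (f s (w v s) x - f s (w v' s) x) \<le> exp (2 * l * s) * (2 * l) * (?d / 2 * norm x)"
            by (simp add: blinfun.diff_left mult_ac)
        qed
        also have "\<dots> \<le> exp (2 * l * c t) * (?d / 2 * norm x)" by simp
        finally show "norm ((J v (c t) - J v' (c t)) x) \<le> exp (2 * l * c t) * (?d / 2) * norm x"
          by (simp add: J_0[OF v] J_0[OF v'] blinfun.diff_left mult_ac)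
      qed simp
      then have "exp (- (2 * l * c t)) * norm (J v (c t) - J v' (c t))
          \<le> exp (- (2 * l * c t)) * (exp (2 * l * c t) * (?d / 2))" by (intro mult_left_mono) auto
      also have "\<dots> = 1 / 2 * ?d" by (simp flip: mult.assoc exp_add)
      finally have "exp (- (2 * l * c t)) * norm (J v (c t) - J v' (c t)) \<le> 1 / 2 * ?d" .
      then show "dist (Bcontfun (\<Psi> v) t) (Bcontfun (\<Psi> v') t) \<le> 1 / 2 * ?d"
        by (simp add: Bcontfun_inverse[OF \<Psi>_bcont] v v' \<Psi>_def dist_norm flip: scaleR_diff_right)
    qed
  qed auto
  then obtain v where v: "v \<in> S" "Bcontfun (\<Psi> v) = v" by blast
  have w_eq: "w v t = u0 + J v t" if t: "t \<in> {0..b}" for t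
  proof -
    have "v t = \<Psi> v t" using v(2) Bcontfun_inverse[OF \<Psi>_bcont[OF v(1)]] by simp
    then show ?thesis by (simp add: w_def \<Psi>_def c(2)[OF t] flip: exp_add)
  qed
  have "((\<lambda>s. w v s x) has_vector_derivative f t (w v t) x) (at t within {0..b})" if t: "t \<in> {0..b}" for t x
  proof (rule has_vector_derivative_transform[OF t])
    show "((\<lambda>s. u0 x + J v s x) has_vector_derivative f t (w v t) x) (at t within {0..b})"
      using has_vector_derivative_add[OF has_vector_derivative_const J_der[OF v(1) t]] by simp
  qed (simp add: w_eq blinfun.add_left)
  moreover have "w v 0 = u0" using w_eq[of 0] b J_0[OF v(1)] by simp
  ultimately show ?thesis using w_cont w_in[OF v(1)] by blast
qed

text \<open>The weighted supremum \<open>W\<close> of \<open>exp (- 2 l t) * norm (d t)\<close> satisfies \<open>W \<le> W / 2\<close>. Differentiability is required only in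
  the weak sense because the adjoint of a strongly differentiable function need not be strongly differentiable.\<close>

lemma weak_gronwall:
  fixes d :: "real \<Rightarrow> 'a::real_normed_vector \<Rightarrow>\<^sub>L 'b::real_inner"
  assumes bd: "bounded (d ` {0..b})" and d0: "d 0 = 0" and l: "0 < l"
    and der: "\<And>t x y. t \<in> {0..b} \<Longrightarrow> ((\<lambda>s. d s x \<bullet> y) has_vector_derivative g t x y) (at t within {0..b})"
    and g: "\<And>t x y. t \<in> {0..b} \<Longrightarrow> \<bar>g t x y\<bar> \<le> l * norm (d t) * norm x * norm y"
    and t: "t \<in> {0..b}"
  shows "d t = 0"
proof -
  define W where "W = (SUP s\<in>{0..b}. exp (- (2 * l * s)) * norm (d s))"
  obtain K where "\<forall>v\<in>d ` {0..b}. norm v \<le> K" using bd unfolding bounded_iff ..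
  then have K: "norm (d s) \<le> K" if "s \<in> {0..b}" for s using that by (rule bspec[OF _ imageI])
  have le: "exp (- (2 * l * s)) * norm (d s) \<le> 1 * K" if "s \<in> {0..b}" for s
    using that K l by (intro mult_mono) auto
  have "bdd_above ((\<lambda>s. exp (- (2 * l * s)) * norm (d s)) ` {0..b})"
    by (rule bdd_aboveI2[OF le])
  then have W: "exp (- (2 * l * s)) * norm (d s) \<le> W" if "s \<in> {0..b}" for s
    unfolding W_def using that by (rule cSUP_upper[rotated])
  have dW: "norm (d s) \<le> exp (2 * l * s) * W" if "s \<in> {0..b}" for s
    using mult_left_mono[OF W[OF that], of "exp (2 * l * s)"] by (simp flip: mult.assoc exp_add)
  have W0: "0 \<le> W" using W[OF t] by (meson exp_ge_zero mult_nonneg_nonneg norm_ge_zero order_trans)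
  have half: "exp (- (2 * l * s)) * norm (d s) \<le> W / 2" if s: "s \<in> {0..b}" for s
  proof -
    have "norm (d s) \<le> exp (2 * l * s) * W / 2"
    proof (rule norm_le_weakI)
      fix x :: 'a and y :: 'b
      let ?N = "W / 2 * (norm x * norm y)"
      have "norm (d s x \<bullet> y - d 0 x \<bullet> y) \<le> exp (2 * l * s) * ?N - exp (2 * l * 0) * ?N"
      proof (rule norm_increment_le[OF der])
        fix r assume r: "r \<in> {0..b}"
        show "((\<lambda>r. exp (2 * l * r) * ?N) has_vector_derivative exp (2 * l * r) * (2 * l) * ?N) (at r within {0..b})"
          unfolding has_real_derivative_iff_has_vector_derivative[symmetric]
          by (auto intro!: derivative_eq_intros)
        have "l * norm (d r) * norm x * norm y \<le> l * (exp (2 * l * r) * W) * norm x * norm y"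
          using l dW[OF r] by (intro mult_right_mono mult_left_mono) auto
        then show "norm (g r x y) \<le> exp (2 * l * r) * (2 * l) * ?N" using g[OF r, of x y] by (simp add: mult_ac)
      qed (use s in auto)
      moreover have "0 \<le> ?N" using W0 by simp
      ultimately show "\<bar>d s x \<bullet> y\<bar> \<le> exp (2 * l * s) * W / 2 * norm x * norm y" by (simp add: d0 mult_ac)
    qed (use W0 in simp)
    from mult_left_mono[OF this, of "exp (- (2 * l * s))"] show ?thesis
      by (simp flip: mult.assoc exp_add)
  qed
  have "W \<le> W / 2" unfolding W_def by (rule cSUP_least) (use half t in \<open>auto simp: W_def\<close>)
  then have "W \<le> 0" by simp
  then have "norm (d t) \<le> 0" using dW[OF t] by (meson exp_ge_zero mult_nonneg_nonpos order_trans)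
  then show ?thesis by simp
qed

section \<open>The forward Riccati equation\<close>

text \<open>\<open>L'\<close> stands for the adjoint of \<open>L\<close>; as a parameter of its own it lets the same formula with \<open>0\<close> for both describe the part
  of the right-hand side that does not involve \<open>L\<close>.\<close>

definition riccati_rhs :: "'h \<Rightarrow>\<^sub>L 'h \<Rightarrow> 'h \<Rightarrow>\<^sub>L 'h \<Rightarrow> 'h \<Rightarrow>\<^sub>L 'h \<Rightarrow> 'h \<Rightarrow>\<^sub>L 'h \<Rightarrow> 'h \<Rightarrow>\<^sub>L 'h
    \<Rightarrow> 'h \<Rightarrow>\<^sub>L 'h \<Rightarrow> 'h::real_normed_vector \<Rightarrow>\<^sub>L 'h" where
  "riccati_rhs L L' G p F u = ((- (p o\<^sub>L G) + L') o\<^sub>L u) + (u o\<^sub>L (L - (G o\<^sub>L p))) - F - (u o\<^sub>L G o\<^sub>L u)"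

lemma riccati_rhs_apply:
  "riccati_rhs L L' G p F u x = L' (u x) - p (G (u x)) + u (L x - G (p x)) - F x - u (G (u x))"
  by (simp add: riccati_rhs_def blinfun.bilinear_simps)

lemma riccati_rhs_lipschitz:
  assumes u: "norm u \<le> c" and v: "norm v \<le> c" and p: "norm p \<le> \<beta>"
  shows "norm (riccati_rhs L L' G p F u - riccati_rhs L L' G p F v)
    \<le> (norm L' + norm L + 2 * (\<beta> * norm G) + 2 * (c * norm G)) * norm (u - v)"
proof (rule norm_blinfun_bound)
  have c: "0 \<le> c" "0 \<le> \<beta>" using u p norm_ge_zero order_trans by blast+
  then show "0 \<le> (norm L' + norm L + 2 * (\<beta> * norm G) + 2 * (c * norm G)) * norm (u - v)" by simp
  fix x
  let ?w = "u - v"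
  have le: "norm (A y) \<le> a * b" if "norm A \<le> a" "norm y \<le> b" for A :: "'a \<Rightarrow>\<^sub>L 'a" and y a b
    by (rule order_trans[OF norm_blinfun mult_mono]) (use that in \<open>auto intro: order_trans[OF norm_ge_zero]\<close>)
  note le' = le[OF order_refl] le[OF p] le[OF u] le[OF v] order_refl
  have "(riccati_rhs L L' G p F u - riccati_rhs L L' G p F v) x
      = L' (?w x) - p (G (?w x)) + ?w (L x) - ?w (G (p x)) - ?w (G (u x)) - v (G (?w x))"
    by (simp add: riccati_rhs_apply blinfun.bilinear_simps)
  also have "norm \<dots> \<le> norm (L' (?w x)) + norm (p (G (?w x))) + norm (?w (L x)) + norm (?w (G (p x)))
      + norm (?w (G (u x))) + norm (v (G (?w x)))"
    by (intro order_trans[OF norm_triangle_ineq4] order_trans[OF norm_triangle_ineq] add_mono order_refl)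
  also have "\<dots> \<le> norm L' * (norm ?w * norm x) + \<beta> * (norm G * (norm ?w * norm x)) + norm ?w * (norm L * norm x)
      + norm ?w * (norm G * (\<beta> * norm x)) + norm ?w * (norm G * (c * norm x)) + c * (norm G * (norm ?w * norm x))"
    by (intro add_mono le')
  also have "\<dots> = (norm L' + norm L + 2 * (\<beta> * norm G) + 2 * (c * norm G)) * norm ?w * norm x"
    by (simp add: algebra_simps)
  finally show "norm ((riccati_rhs L L' G p F u - riccati_rhs L L' G p F v) x)
      \<le> (norm L' + norm L + 2 * (\<beta> * norm G) + 2 * (c * norm G)) * norm ?w * norm x" .
qed

lemma riccati_rhs_continuous:
  fixes S :: "real set"
  assumes u: "continuous_on S u" and P: "\<And>x. continuous_on S (\<lambda>s. blinfun_apply (P s) x)"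
    and \<beta>: "\<And>s. s \<in> S \<Longrightarrow> norm (P s) \<le> \<beta>"
  shows "continuous_on S (\<lambda>s. riccati_rhs L L' G (P s) F (u s) x)"
proof -
  note const = bounded_linear.continuous_on[OF blinfun.bounded_linear_right]
  have ux: "continuous_on S (\<lambda>s. u s x)" for x by (rule blinfun.continuous_on[OF u continuous_on_const])
  have "continuous_on S (\<lambda>s. P s (G (u s x)))"
    by (intro continuous_on_strong_apply[OF \<beta> P] const ux)
  moreover have "continuous_on S (\<lambda>s. u s (L x - G (P s x)))"
    by (intro blinfun.continuous_on[OF u] continuous_on_diff continuous_on_const const P)
  moreover have "continuous_on S (\<lambda>s. u s (G (u s x)))"
    by (intro blinfun.continuous_on[OF u] const ux)
  ultimately show ?thesis
    unfolding riccati_rhs_apply by (intro continuous_on_add continuous_on_diff continuous_on_const const ux)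
qed

lemma riccati_strict_solution_iff:
  "riccati_strict_solution X \<tau> L G T P F \<eta>\<^sub>0 \<eta> \<longleftrightarrow>
     \<eta> \<in> C1s {0..\<tau>} X \<and> \<eta> 0 = \<eta>\<^sub>0 \<and>
     (\<forall>t\<in>{0..\<tau>}. \<forall>x. ((\<lambda>s. \<eta> s x) has_vector_derivative
        riccati_rhs L (adj L) G (P (T - t)) F (\<eta> t) x) (at t within {0..\<tau>}))"
  by (simp add: riccati_strict_solution_def riccati_rhs_def blinfun.bilinear_simps)

lemma strict_solution_bounded:
  fixes \<eta> :: "real \<Rightarrow> 'h::{real_inner, banach} \<Rightarrow>\<^sub>L 'h"
  assumes "riccati_strict_solution X \<tau> L G T P F \<eta>\<^sub>0 \<eta>"
  shows "bounded (\<eta> ` {0..\<tau>})"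
proof (rule strongly_continuous_bounded)
  show "continuous_on {0..\<tau>} (\<lambda>t. \<eta> t x)" for x
    unfolding continuous_on_eq_continuous_within
    using assms unfolding riccati_strict_solution_iff by (blast intro: has_vector_derivative_continuous)
qed simp

text \<open>The right-hand side commutes with taking adjoints when its data are self-adjoint; this is what makes the solutions
  self-adjoint.\<close>

lemma riccati_rhs_adj:
  fixes L G p F u :: "'h::{real_inner, banach} \<Rightarrow>\<^sub>L 'h"
  assumes "G \<in> selfadjoint_ops" "p \<in> selfadjoint_ops" "F \<in> selfadjoint_ops"
  shows "x \<bullet> riccati_rhs L (adj L) G p F u y = riccati_rhs L (adj L) G p F (adj u) x \<bullet> y"
proof -
  have sa: "x \<bullet> A y = A x \<bullet> y" if "A \<in> selfadjoint_ops" for A :: "'h \<Rightarrow>\<^sub>L 'h" and x y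
    using that by (simp add: selfadjoint_ops_def)
  have adj: "x \<bullet> u y = adj u x \<bullet> y" "x \<bullet> L y = adj L x \<bullet> y" "x \<bullet> adj L y = L x \<bullet> y" for x y
    by (metis inner_adj inner_commute)+
  show ?thesis
    by (simp add: riccati_rhs_apply inner_simps blinfun.bilinear_simps adj sa assms)
qed

lemma norm_adj_le: "norm (adj u) \<le> norm (u :: 'h::{real_inner, banach} \<Rightarrow>\<^sub>L 'h)"
proof (rule norm_le_weakI)
  show "\<bar>adj u x \<bullet> y\<bar> \<le> norm u * norm x * norm y" for x y
  proof -
    have "adj u x \<bullet> y = u y \<bullet> x" by (metis inner_adj inner_commute)
    then show ?thesis using inner_blinfun_le[of u y x] by (simp add: mult_ac)
  qed
qed simp

lemma strict_solution_unique:
  fixes \<eta> \<zeta> :: "real \<Rightarrow> 'h::{real_inner, banach} \<Rightarrow>\<^sub>L 'h"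
  assumes \<eta>: "riccati_strict_solution UNIV \<tau> L G T P F \<eta>\<^sub>0 \<eta>"
    and \<zeta>: "riccati_strict_solution UNIV \<tau> L G T P F \<eta>\<^sub>0 \<zeta>"
    and \<beta>: "\<And>t. t \<in> {0..\<tau>} \<Longrightarrow> norm (P (T - t)) \<le> \<beta>" and t: "t \<in> {0..\<tau>}"
  shows "\<zeta> t = \<eta> t"
proof -
  obtain c1 c2 where "\<forall>u\<in>\<eta> ` {0..\<tau>}. norm u \<le> c1" "\<forall>u\<in>\<zeta> ` {0..\<tau>}. norm u \<le> c2"
    using strict_solution_bounded[OF \<eta>] strict_solution_bounded[OF \<zeta>] unfolding bounded_iff by blast
  then have c: "norm (\<eta> s) \<le> max c1 c2" "norm (\<zeta> s) \<le> max c1 c2" if "s \<in> {0..\<tau>}" for s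
    using that by (auto simp: le_max_iff_disj)
  define l where "l = norm (adj L) + norm L + 2 * (\<beta> * norm G) + 2 * (max c1 c2 * norm G)"
  define g where "g s x y = (riccati_rhs L (adj L) G (P (T - s)) F (\<zeta> s) - riccati_rhs L (adj L) G (P (T - s)) F (\<eta> s)) x \<bullet> y" for s x y
  have "(\<zeta> t - \<eta> t) = 0"
  proof (rule weak_gronwall[where l = "max l 1" and b = \<tau> and g = g])
    show "bounded ((\<lambda>s. \<zeta> s - \<eta> s) ` {0..\<tau>})"
      by (rule bounded_minus_comp) (use strict_solution_bounded \<eta> \<zeta> in auto)
    show "\<zeta> 0 - \<eta> 0 = 0" using \<eta> \<zeta> by (simp add: riccati_strict_solution_iff)
    fix s x y assume s: "s \<in> {0..\<tau>}"
    have "((\<lambda>s. \<zeta> s x - \<eta> s x) has_vector_derivative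
        riccati_rhs L (adj L) G (P (T - s)) F (\<zeta> s) x - riccati_rhs L (adj L) G (P (T - s)) F (\<eta> s) x) (at s within {0..\<tau>})"
      by (rule has_vector_derivative_diff) (use \<eta> \<zeta> s in \<open>auto simp: riccati_strict_solution_iff\<close>)
    from bounded_linear.has_vector_derivative[OF bounded_linear_inner_left this, of y]
    show "((\<lambda>s. (\<zeta> s - \<eta> s) x \<bullet> y) has_vector_derivative g s x y) (at s within {0..\<tau>})"
      by (simp add: g_def blinfun.diff_left)
    have "\<bar>g s x y\<bar> \<le> (l * norm (\<zeta> s - \<eta> s)) * norm x * norm y"
      unfolding g_def l_def using s
      by (intro order_trans[OF inner_blinfun_le] mult_right_mono riccati_rhs_lipschitz c \<beta>) auto
    also have "\<dots> \<le> (max l 1 * norm (\<zeta> s - \<eta> s)) * norm x * norm y"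
      by (intro mult_right_mono) auto
    finally show "\<bar>g s x y\<bar> \<le> max l 1 * norm (\<zeta> s - \<eta> s) * norm x * norm y" .
  qed (use t in auto)
  then show ?thesis by simp
qed

text \<open>By the lemma \<open>riccati_rhs_adj\<close>, the adjoint of a solution solves the same equation, but only in the weak sense. This
  is enough for the Gronwall argument to show that it coincides with the solution.\<close>

lemma strict_solution_selfadjoint:
  fixes \<eta> :: "real \<Rightarrow> 'h::{real_inner, banach} \<Rightarrow>\<^sub>L 'h"
  assumes \<eta>: "riccati_strict_solution UNIV \<tau> L G T P F \<eta>\<^sub>0 \<eta>"
    and sa: "G \<in> selfadjoint_ops" "F \<in> selfadjoint_ops" "\<eta>\<^sub>0 \<in> selfadjoint_ops"
    and P: "\<And>t. t \<in> {0..\<tau>} \<Longrightarrow> P (T - t) \<in> selfadjoint_ops"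
    and \<beta>: "\<And>t. t \<in> {0..\<tau>} \<Longrightarrow> norm (P (T - t)) \<le> \<beta>"
    and t: "t \<in> {0..\<tau>}"
  shows "\<eta> t \<in> selfadjoint_ops"
proof -
  obtain c where "\<forall>u\<in>\<eta> ` {0..\<tau>}. norm u \<le> c"
    using strict_solution_bounded[OF \<eta>] unfolding bounded_iff by blast
  then have c: "norm (\<eta> s) \<le> c" if "s \<in> {0..\<tau>}" for s using that by simp
  then have c': "norm (adj (\<eta> s)) \<le> c" if "s \<in> {0..\<tau>}" for s using that norm_adj_le order_trans by blast
  define l where "l = norm (adj L) + norm L + 2 * (\<beta> * norm G) + 2 * (c * norm G)"
  define g where "g s x y = (riccati_rhs L (adj L) G (P (T - s)) F (\<eta> s) - riccati_rhs L (adj L) G (P (T - s)) F (adj (\<eta> s))) x \<bullet> y" for s x y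
  have der: "((\<lambda>s. \<eta> s x) has_vector_derivative riccati_rhs L (adj L) G (P (T - s)) F (\<eta> s) x) (at s within {0..\<tau>})"
    if "s \<in> {0..\<tau>}" for s x using \<eta> that by (simp add: riccati_strict_solution_iff)
  have "\<eta> t - adj (\<eta> t) = 0"
  proof (rule weak_gronwall[where l = "max l 1" and b = \<tau> and g = g])
    show "bounded ((\<lambda>s. \<eta> s - adj (\<eta> s)) ` {0..\<tau>})"
      by (rule bounded_minus_comp[OF boundedI[where B = c] boundedI[where B = c]]) (use c c' in auto)
    have "adj \<eta>\<^sub>0 = \<eta>\<^sub>0"
      by (rule blinfun_eq_weakI) (use sa(3) in \<open>simp add: inner_adj selfadjoint_ops_def\<close>)
    then show "\<eta> 0 - adj (\<eta> 0) = 0" using \<eta> by (simp add: riccati_strict_solution_iff)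
    fix s x y assume s: "s \<in> {0..\<tau>}"
    have "((\<lambda>s. \<eta> s x \<bullet> y - x \<bullet> \<eta> s y) has_vector_derivative
        riccati_rhs L (adj L) G (P (T - s)) F (\<eta> s) x \<bullet> y - x \<bullet> riccati_rhs L (adj L) G (P (T - s)) F (\<eta> s) y) (at s within {0..\<tau>})"
      by (intro has_vector_derivative_diff bounded_linear.has_vector_derivative[OF bounded_linear_inner_left]
          bounded_linear.has_vector_derivative[OF bounded_linear_inner_right] der s)
    moreover have "x \<bullet> riccati_rhs L (adj L) G (P (T - s)) F (\<eta> s) y
        = riccati_rhs L (adj L) G (P (T - s)) F (adj (\<eta> s)) x \<bullet> y"
      by (rule riccati_rhs_adj[OF sa(1) P[OF s] sa(2)])
    ultimately show "((\<lambda>s. (\<eta> s - adj (\<eta> s)) x \<bullet> y) has_vector_derivative g s x y) (at s within {0..\<tau>})"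
      by (simp add: g_def blinfun.diff_left inner_diff_left inner_adj)
    have "\<bar>g s x y\<bar> \<le> (l * norm (\<eta> s - adj (\<eta> s))) * norm x * norm y"
      unfolding g_def l_def using s
      by (intro order_trans[OF inner_blinfun_le] mult_right_mono riccati_rhs_lipschitz c c' \<beta>) auto
    also have "\<dots> \<le> (max l 1 * norm (\<eta> s - adj (\<eta> s))) * norm x * norm y"
      by (intro mult_right_mono) auto
    finally show "\<bar>g s x y\<bar> \<le> max l 1 * norm (\<eta> s - adj (\<eta> s)) * norm x * norm y" .
  qed (use t in auto)
  then have "adj (\<eta> t) = \<eta> t" by simp
  then show ?thesis unfolding selfadjoint_ops_def by (simp, metis inner_adj)
qed

text \<open>The length \<open>\<tau>\<close> depends on \<open>L\<close> only through \<open>c\<close>, not through \<open>\<nu>\<close> or the norm of \<open>L\<close>. To achieve this, the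
  linear part \<open>\<eta> \<mapsto> adj L \<eta> + \<eta> L\<close> is shifted by \<open>2 \<nu>\<close>, so that in the norm dual to \<open>p\<close> it is bounded by
  \<open>2 (\<nu> + c)\<close>, and the shift is undone by the substitution \<open>u t = exp (2 \<nu> t) \<eta> t\<close>, which takes back exactly \<open>2 \<nu>\<close>.
  What remains is growth at rate \<open>2 c\<close>: the tube of radius \<open>R t = norm \<eta>\<^sub>0 + \<mu> t\<close> is invariant as long as \<open>R t \<le> r\<close>.\<close>

lemma strict_solution_exists:
  fixes p :: "'h::{real_inner, banach} \<Rightarrow> real" and L G F \<eta>\<^sub>0 :: "'h \<Rightarrow>\<^sub>L 'h"
    and P :: "real \<Rightarrow> 'h \<Rightarrow>\<^sub>L 'h"
  assumes \<tau>: "0 < \<tau>" "\<tau> \<le> T" "\<mu> * \<tau> \<le> 1"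
    and p: "\<And>x. norm x \<le> p x" "\<And>x. p x \<le> M * norm x"
    and \<nu>: "0 \<le> \<nu>" "0 \<le> c" and L: "\<And>x. p (L x + \<nu> *\<^sub>R x) \<le> (\<nu> + c) * p x"
    and P: "\<And>x. continuous_on {0..T} (\<lambda>t. P t x)" and \<beta>: "\<And>t. t \<in> {0..T} \<Longrightarrow> norm (P t) \<le> \<beta>"
    and r: "norm \<eta>\<^sub>0 + 1 \<le> r"
    and \<mu>: "2 * c * r + (2 * (\<beta> * norm G * (M\<^sup>2 * r)) + norm F + norm G * (M\<^sup>2 * r)\<^sup>2) \<le> \<mu>"
  shows "\<exists>\<eta>. riccati_strict_solution UNIV \<tau> L G T P F \<eta>\<^sub>0 \<eta>"
proof -
  define N where "N = 2 * (\<beta> * norm G * (M\<^sup>2 * r)) + norm F + norm G * (M\<^sup>2 * r)\<^sup>2"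
  have p0: "0 \<le> p x" for x using p(1) norm_ge_zero order_trans by blast
  have \<beta>0: "0 \<le> \<beta>" using order_trans[OF norm_ge_zero \<beta>[of T]] \<tau> by simp
  have r0: "0 < r" using r norm_ge_zero[of \<eta>\<^sub>0] by linarith
  have N0: "0 \<le> N" unfolding N_def using \<beta>0 r0 by (intro add_nonneg_nonneg mult_nonneg_nonneg) auto
  have "0 \<le> 2 * c * r" using \<nu> r0 by simp
  then have \<mu>0: "0 \<le> \<mu>" using \<mu> N0 unfolding N_def by linarith
  define R where "R t = norm \<eta>\<^sub>0 + \<mu> * t" for t
  have R: "0 \<le> R t" "R t \<le> r" if "t \<in> {0..\<tau>}" for t
  proof -
    have "\<mu> * t \<le> \<mu> * \<tau>" using that \<mu>0 by (intro mult_left_mono) auto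
    then show "R t \<le> r" using r \<tau>(3) by (simp add: R_def)
    show "0 \<le> R t" using that \<mu>0 by (simp add: R_def)
  qed
  define rhs where "rhs t = riccati_rhs L (adj L) G (P (T - t)) F" for t
  define e where "e t = exp (2 * \<nu> * t)" for t
  define f where "f t u = e t *\<^sub>R rhs t (u /\<^sub>R e t) + (2 * \<nu>) *\<^sub>R u" for t u
  have e0: "0 < e t" for t by (simp add: e_def)
  have pp: "p x * p y \<le> M\<^sup>2 * (norm x * norm y)" for x y
    using mult_mono[OF p(2) p(2), of x y] p0 p by (simp add: power2_eq_square mult_ac order_trans[OF p0 p(2)])
  have ball_norm: "norm u \<le> a * M\<^sup>2" if "u \<in> form_ball p a" "0 \<le> a" for u a
  proof (rule norm_le_weakI)
    show "\<bar>u x \<bullet> y\<bar> \<le> a * M\<^sup>2 * norm x * norm y" for x y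
    proof -
      have "\<bar>u x \<bullet> y\<bar> \<le> a * (p x * p y)" using that by (simp add: form_ball_def)
      also have "\<dots> \<le> a * (M\<^sup>2 * (norm x * norm y))" by (rule mult_left_mono[OF pp that(2)])
      finally show ?thesis by (simp add: mult_ac)
    qed
  qed (use that in simp)
  have norm_ball: "\<bar>u x \<bullet> y\<bar> \<le> a * (p x * p y)" if "norm u \<le> a" for u :: "'h \<Rightarrow>\<^sub>L 'h" and a x y
  proof -
    have "\<bar>u x \<bullet> y\<bar> \<le> norm u * (norm x * norm y)" using inner_blinfun_le[of u x y] by (simp add: mult_ac)
    also have "\<dots> \<le> a * (p x * p y)"
      using that p0 p(1) order_trans[OF norm_ge_zero that] by (intro mult_mono) auto
    finally show ?thesis .
  qed
  have P': "continuous_on {0..\<tau>} (\<lambda>t. P (T - t) x)" for x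
    by (rule continuous_on_compose2[OF P]) (use \<tau> in \<open>auto intro!: continuous_intros\<close>)
  have \<beta>': "norm (P (T - t)) \<le> \<beta>" if "t \<in> {0..\<tau>}" for t using \<beta> that \<tau> by simp
  have scale: "u /\<^sub>R e t \<in> form_ball p (R t)" if "u \<in> form_ball p (e t * R t)" for u t
    using that e0[of t] by (auto simp: form_ball_def blinfun.scaleR_left field_simps)
  have ball: "norm (u /\<^sub>R e t) \<le> r * M\<^sup>2" if "u \<in> form_ball p (e t * R t)" "t \<in> {0..\<tau>}" for u t
    using ball_norm[OF scale[OF that(1)]] R[OF that(2)] by (meson mult_right_mono order_trans zero_le_power2)
  have inv: "f t u \<in> form_ball p (e t * (2 * \<nu> * R t + \<mu>))" if t: "t \<in> {0..\<tau>}" and u: "u \<in> form_ball p (e t * R t)" for t u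
  proof -
    define \<eta> where "\<eta> = u /\<^sub>R e t"
    have \<eta>: "\<eta> \<in> form_ball p (R t)" using scale[OF u] by (simp add: \<eta>_def)
    have \<eta>n: "norm \<eta> \<le> M\<^sup>2 * r" using ball[OF u t] by (simp add: \<eta>_def mult.commute)
    have f: "f t u = e t *\<^sub>R (rhs t \<eta> + (2 * \<nu>) *\<^sub>R \<eta>)"
      using e0[of t] by (simp add: f_def \<eta>_def scaleR_add_right)
    \<comment> \<open>the part of the right-hand side without \<open>L\<close>; here the operator norm is good enough\<close>
    define W where "W = riccati_rhs 0 0 G (P (T - t)) F \<eta>"
    have "norm W \<le> N"
    proof -
      have le: "norm (A o\<^sub>L B) \<le> a * b" if "norm A \<le> a" "norm B \<le> b" for A B :: "'h \<Rightarrow>\<^sub>L 'h" and a b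
        by (rule order_trans[OF norm_blinfun_compose mult_mono]) (use that in \<open>auto intro: order_trans[OF norm_ge_zero]\<close>)
      have "W = - (P (T - t) o\<^sub>L G o\<^sub>L \<eta>) - (\<eta> o\<^sub>L (G o\<^sub>L P (T - t))) - F - (\<eta> o\<^sub>L G o\<^sub>L \<eta>)"
        by (rule blinfun_eqI) (simp add: W_def riccati_rhs_apply blinfun.bilinear_simps)
      also have "norm \<dots> \<le> norm (P (T - t) o\<^sub>L G o\<^sub>L \<eta>) + norm (\<eta> o\<^sub>L (G o\<^sub>L P (T - t))) + norm F + norm (\<eta> o\<^sub>L G o\<^sub>L \<eta>)"
        by (intro order_trans[OF norm_triangle_ineq4] add_mono order_refl) simp
      also have "\<dots> \<le> (\<beta> * norm G) * (M\<^sup>2 * r) + (M\<^sup>2 * r) * (norm G * \<beta>) + norm F + (M\<^sup>2 * r) * norm G * (M\<^sup>2 * r)"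
        by (intro add_mono le order_refl \<beta>'[OF t] \<eta>n)
      also have "\<dots> = N" by (simp add: N_def power2_eq_square)
      finally show ?thesis .
    qed
    have "\<bar>(rhs t \<eta> + (2 * \<nu>) *\<^sub>R \<eta>) x \<bullet> y\<bar> \<le> (2 * \<nu> * R t + \<mu>) * (p x * p y)" for x y
    proof -
      let ?L = "\<lambda>x. L x + \<nu> *\<^sub>R x"
      have "(rhs t \<eta> + (2 * \<nu>) *\<^sub>R \<eta>) x \<bullet> y = \<eta> x \<bullet> ?L y + \<eta> (?L x) \<bullet> y + W x \<bullet> y"
        by (simp add: rhs_def W_def riccati_rhs_apply blinfun.bilinear_simps inner_simps inner_adj)
      moreover have "\<bar>\<eta> x \<bullet> ?L y\<bar> \<le> R t * ((\<nu> + c) * (p x * p y))" "\<bar>\<eta> (?L x) \<bullet> y\<bar> \<le> R t * ((\<nu> + c) * (p x * p y))"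
      proof -
        have ball: "\<bar>\<eta> x \<bullet> y\<bar> \<le> R t * b" if "p x * p y \<le> b" for x y b
        proof -
          have "\<bar>\<eta> x \<bullet> y\<bar> \<le> R t * (p x * p y)" using \<eta> by (simp add: form_ball_def)
          also have "\<dots> \<le> R t * b" by (rule mult_left_mono[OF that R(1)[OF t]])
          finally show ?thesis .
        qed
        have "p x * p (?L y) \<le> (\<nu> + c) * (p x * p y)"
          using mult_left_mono[OF L[of y] p0[of x]] by (simp add: mult_ac)
        then show "\<bar>\<eta> x \<bullet> ?L y\<bar> \<le> R t * ((\<nu> + c) * (p x * p y))" by (rule ball)
        have "p (?L x) * p y \<le> (\<nu> + c) * (p x * p y)"
          using mult_right_mono[OF L[of x] p0[of y]] by (simp add: mult_ac)
        then show "\<bar>\<eta> (?L x) \<bullet> y\<bar> \<le> R t * ((\<nu> + c) * (p x * p y))" by (rule ball)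
      qed
      moreover have "\<bar>W x \<bullet> y\<bar> \<le> N * (p x * p y)" by (rule norm_ball) fact
      ultimately have "\<bar>(rhs t \<eta> + (2 * \<nu>) *\<^sub>R \<eta>) x \<bullet> y\<bar> \<le> (2 * \<nu> * R t + (2 * c * R t + N)) * (p x * p y)"
        by (simp add: algebra_simps)
      also have "\<dots> \<le> (2 * \<nu> * R t + \<mu>) * (p x * p y)"
      proof (intro mult_right_mono add_left_mono)
        have "2 * c * R t \<le> 2 * c * r" using R(2)[OF t] \<nu> by (intro mult_left_mono) auto
        then show "2 * c * R t + N \<le> \<mu>" using \<mu> by (simp add: N_def)
      qed (use p0 in simp)
      finally show ?thesis .
    qed
    then show ?thesis using e0[of t]
      by (simp add: f form_ball_def blinfun.scaleR_left abs_mult)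
  qed
  define l where "l = norm (adj L) + norm L + 2 * (\<beta> * norm G) + 2 * (r * M\<^sup>2 * norm G) + 2 * \<nu> + 1"
  have l0: "0 < l" unfolding l_def using \<beta>0 r0 \<nu> by (intro add_nonneg_pos add_nonneg_nonneg mult_nonneg_nonneg) auto
  \<comment> \<open>the curve \<open>w\<close> is \<open>u\<close>, with tube radius \<open>e t * R t\<close>, whose derivative is \<open>e t * (2 * \<nu> * R t + \<mu>)\<close>\<close>
  obtain w where w: "continuous_on {0..\<tau>} w" "w 0 = \<eta>\<^sub>0"
    "\<And>t x. t \<in> {0..\<tau>} \<Longrightarrow> ((\<lambda>s. w s x) has_vector_derivative f t (w t) x) (at t within {0..\<tau>})"
  proof -
    have "\<exists>w. continuous_on {0..\<tau>} w \<and> w 0 = \<eta>\<^sub>0 \<and> (\<forall>t\<in>{0..\<tau>}. w t \<in> form_ball p (e t * R t) \<and>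
           (\<forall>x. ((\<lambda>s. w s x) has_vector_derivative f t (w t) x) (at t within {0..\<tau>})))"
    proof (rule strong_picard_in_form_balls[where l = l and \<rho>' = "\<lambda>t. e t * (2 * \<nu> * R t + \<mu>)"
          and C = "e \<tau> * (2 * \<nu> * r + \<mu>) * M\<^sup>2"])
      show "continuous_on {0..\<tau>} (\<lambda>s. f s (w s) x)" if w: "continuous_on {0..\<tau>} w" for w x
        unfolding f_def rhs_def blinfun.add_left blinfun.scaleR_left e_def
        by (intro continuous_intros riccati_rhs_continuous[OF _ P' \<beta>'] w) auto
      show "norm (f s u) \<le> e \<tau> * (2 * \<nu> * r + \<mu>) * M\<^sup>2" if s: "s \<in> {0..\<tau>}" and u: "u \<in> form_ball p (e s * R s)" for s u
      proof -
        have nn: "0 \<le> 2 * \<nu> * R s + \<mu>" using R(1)[OF s] \<nu> \<mu>0 by simp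
        have "norm (f s u) \<le> e s * (2 * \<nu> * R s + \<mu>) * M\<^sup>2"
          using ball_norm[OF inv[OF s u]] e0[of s] nn by simp
        also have "\<dots> \<le> e \<tau> * (2 * \<nu> * r + \<mu>) * M\<^sup>2"
        proof (intro mult_right_mono mult_mono nn)
          show "e s \<le> e \<tau>" using s \<nu> by (simp add: e_def mult_left_mono)
          show "2 * \<nu> * R s + \<mu> \<le> 2 * \<nu> * r + \<mu>" using R(2)[OF s] \<nu> by (simp add: mult_left_mono)
        qed (use e0 less_imp_le in auto)
        finally show ?thesis .
      qed
      show "norm (f s u - f s v) \<le> l * norm (u - v)"
        if s: "s \<in> {0..\<tau>}" and u: "u \<in> form_ball p (e s * R s)" and v: "v \<in> form_ball p (e s * R s)" for s u v
      proof -
        define l' where "l' = norm (adj L) + norm L + 2 * (\<beta> * norm G) + 2 * (r * M\<^sup>2 * norm G)"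
        let ?\<Delta> = "rhs s (u /\<^sub>R e s) - rhs s (v /\<^sub>R e s)"
        have "norm (rhs s (u /\<^sub>R e s) - rhs s (v /\<^sub>R e s)) \<le> l' * norm (u /\<^sub>R e s - v /\<^sub>R e s)"
          unfolding rhs_def l'_def by (intro riccati_rhs_lipschitz ball \<beta>' s u v)
        also have "u /\<^sub>R e s - v /\<^sub>R e s = (u - v) /\<^sub>R e s" by (simp add: scaleR_diff_right)
        finally have "e s * norm ?\<Delta> \<le> e s * (l' * norm ((u - v) /\<^sub>R e s))"
          using e0[of s] by (intro mult_left_mono) auto
        also have "\<dots> = l' * norm (u - v)" using e0[of s] by simp
        finally have *: "norm (e s *\<^sub>R ?\<Delta>) \<le> l' * norm (u - v)" using e0[of s] by simp
        have diff: "f s u - f s v = e s *\<^sub>R (rhs s (u /\<^sub>R e s) - rhs s (v /\<^sub>R e s)) + (2 * \<nu>) *\<^sub>R (u - v)"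
          by (simp add: f_def algebra_simps)
        have "norm (f s u - f s v) \<le> l' * norm (u - v) + norm ((2 * \<nu>) *\<^sub>R (u - v))"
          unfolding diff by (rule order_trans[OF norm_triangle_ineq add_right_mono[OF *]])
        also have "\<dots> \<le> l * norm (u - v)" using \<nu> by (simp add: l_def l'_def distrib_right)
        finally show ?thesis .
      qed
      show "\<eta>\<^sub>0 \<in> form_ball p (e 0 * R 0)" using norm_ball[OF order_refl, of \<eta>\<^sub>0] by (simp add: form_ball_def e_def R_def)
      show "((\<lambda>s. e s * R s) has_vector_derivative e s * (2 * \<nu> * R s + \<mu>)) (at s within {0..\<tau>})" for s
        unfolding has_real_derivative_iff_has_vector_derivative[symmetric] e_def R_def
        by (auto intro!: derivative_eq_intros simp: algebra_simps)
      show "0 \<le> e s * R s" if "s \<in> {0..\<tau>}" for s using R(1)[OF that] e0[of s] by simp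
    qed (use \<tau> l0 p0 inv in auto)
    then show ?thesis using that by blast
  qed
  define \<eta> where "\<eta> t = w t /\<^sub>R e t" for t
  have \<eta>_der: "((\<lambda>s. \<eta> s x) has_vector_derivative rhs t (\<eta> t) x) (at t within {0..\<tau>})" if t: "t \<in> {0..\<tau>}" for t x
  proof -
    have d: "((\<lambda>s. exp (- (2 * \<nu> * s))) has_real_derivative - (2 * \<nu>) * exp (- (2 * \<nu> * t))) (at t within {0..\<tau>})"
      by (auto intro!: derivative_eq_intros)
    have "((\<lambda>s. exp (- (2 * \<nu> * s)) *\<^sub>R w s x) has_vector_derivative
        exp (- (2 * \<nu> * t)) *\<^sub>R f t (w t) x + (- (2 * \<nu>) * exp (- (2 * \<nu> * t))) *\<^sub>R w t x) (at t within {0..\<tau>})"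
      by (rule has_vector_derivative_scaleR[OF d w(3)[OF t]])
    moreover have "exp (- (2 * \<nu> * t)) *\<^sub>R f t (w t) x + (- (2 * \<nu>) * exp (- (2 * \<nu> * t))) *\<^sub>R w t x = rhs t (\<eta> t) x"
      by (simp add: f_def \<eta>_def e_def blinfun.bilinear_simps exp_minus scaleR_add_right)
    ultimately show ?thesis by (simp add: \<eta>_def e_def blinfun.scaleR_left exp_minus)
  qed
  have \<eta>_cont: "continuous_on {0..\<tau>} \<eta>" unfolding \<eta>_def e_def by (intro continuous_intros w) auto
  have "riccati_strict_solution UNIV \<tau> L G T P F \<eta>\<^sub>0 \<eta>"
    unfolding riccati_strict_solution_iff
  proof (intro conjI ballI allI)
    show "\<eta> 0 = \<eta>\<^sub>0" by (simp add: \<eta>_def e_def w)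
    show "((\<lambda>s. \<eta> s x) has_vector_derivative riccati_rhs L (adj L) G (P (T - t)) F (\<eta> t) x) (at t within {0..\<tau>})"
      if "t \<in> {0..\<tau>}" for t x using \<eta>_der[OF that] by (simp add: rhs_def)
    have "continuous_on {0..\<tau>} (\<lambda>t. rhs t (\<eta> t) x)" for x
      unfolding rhs_def by (rule riccati_rhs_continuous[OF \<eta>_cont P' \<beta>'])
    then show "\<eta> \<in> C1s {0..\<tau>} UNIV" unfolding C1s_def using \<eta>_der by blast
  qed
  then show ?thesis by blast
qed

lemma selfadjoint_ops_uminus: "A \<in> selfadjoint_ops \<Longrightarrow> - A \<in> selfadjoint_ops"
  by (simp add: selfadjoint_ops_def blinfun.minus_left)

theorem propositionA2:
  fixes D :: "'h::{real_inner, banach, second_countable_topology} set"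
    and A :: "'h \<Rightarrow> 'h"
    and E :: "real \<Rightarrow> 'h \<Rightarrow>\<^sub>L 'h"
    and B :: "'u::{real_inner, banach, second_countable_topology} \<Rightarrow>\<^sub>L 'h"
    and R :: "'u \<Rightarrow>\<^sub>L 'u"
    and Q Q\<^sub>T Qbar Qbar\<^sub>T S S\<^sub>T :: "'h \<Rightarrow>\<^sub>L 'h"
    and \<sigma> :: "'k::{real_inner, banach, second_countable_topology} \<Rightarrow>\<^sub>L 'h"
    and T M \<omega> \<epsilon> :: real
    and P :: "real \<Rightarrow> 'h \<Rightarrow>\<^sub>L 'h"
  assumes "closed_densely_defined D A" and "C0_semigroup E" and "is_generator D A E"
    and "M \<ge> 1" and "\<forall>t\<ge>0. norm (E t) \<le> M * exp (\<omega> * t)"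
    and "Q \<in> nonneg_ops" and "Q\<^sub>T \<in> nonneg_ops"
    and "Qbar \<in> selfadjoint_ops" and "Qbar\<^sub>T \<in> selfadjoint_ops"
    and "Q + Qbar \<in> nonneg_ops" and "Q\<^sub>T + Qbar\<^sub>T \<in> nonneg_ops"
    and "R \<in> selfadjoint_ops" and "\<epsilon> > 0" and "\<forall>\<alpha>. R \<alpha> \<bullet> \<alpha> \<ge> \<epsilon> * (norm \<alpha>)\<^sup>2"
    and "T > 0"
    and "riccati_mild_solution E (control_op B R) (Q + Qbar) (Q\<^sub>T + Qbar\<^sub>T) T P"
  shows "\<exists>\<tau>>0. \<tau> \<le> T \<and> (\<forall>n::nat. n \<ge> 1 \<and> real n > \<omega> \<longrightarrow>
           riccati_unique_strict_solution UNIV \<tau> (yosida D A n) (control_op B R) T P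
             (Qbar o\<^sub>L S) (- (Qbar\<^sub>T o\<^sub>L S\<^sub>T))
         \<and> (Qbar o\<^sub>L S \<in> selfadjoint_ops \<and> Qbar\<^sub>T o\<^sub>L S\<^sub>T \<in> selfadjoint_ops \<longrightarrow>
           riccati_unique_strict_solution selfadjoint_ops \<tau> (yosida D A n) (control_op B R) T P
             (Qbar o\<^sub>L S) (- (Qbar\<^sub>T o\<^sub>L S\<^sub>T))))"
proof -
  define G where "G = control_op B R"
  define F where "F = Qbar o\<^sub>L S"
  define \<eta>\<^sub>0 where "\<eta>\<^sub>0 = - (Qbar\<^sub>T o\<^sub>L S\<^sub>T)"
  interpret exp_bounded_semigroup E M \<omega>
    by unfold_locales (use assms(2,5) in auto)
  have G: "G \<in> selfadjoint_ops"
    unfolding G_def by (rule control_op_selfadjoint[of \<epsilon>]) (use assms(12-14) in auto)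
  have P: "P \<in> Cs {0..T} nonneg_ops" using assms(16) by (simp add: riccati_mild_solution_def)
  have P_cont: "continuous_on {0..T} (\<lambda>t. P t x)" for x using P by (simp add: Cs_def)
  have P_sa: "P t \<in> selfadjoint_ops" if "t \<in> {0..T}" for t using P that by (auto simp: Cs_def nonneg_ops_def)
  obtain \<beta> where \<beta>: "\<And>t. t \<in> {0..T} \<Longrightarrow> norm (P t) \<le> \<beta>"
    using strongly_continuous_bounded[OF compact_Icc P_cont] unfolding bounded_iff by blast
  obtain c where c: "c \<ge> 0" "\<And>n::nat. real n > \<omega> \<Longrightarrow> (real n)\<^sup>2 / (real n - \<omega>) \<le> real n + c"
    using yosida_growth_bound[of \<omega>] by blast
  \<comment> \<open>\<open>\<mu>\<close> bounds the growth of the tube while its radius is at most \<open>r\<close>, so the radius stays below \<open>r\<close> while \<open>\<mu> * t \<le> 1\<close>\<close>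
  define r where "r = norm \<eta>\<^sub>0 + 1"
  define \<mu> where "\<mu> = 2 * c * r + (2 * (\<beta> * norm G * (M\<^sup>2 * r)) + norm F + norm G * (M\<^sup>2 * r)\<^sup>2)"
  define \<tau> where "\<tau> = min T (1 / (\<bar>\<mu>\<bar> + 1))"
  have \<tau>: "0 < \<tau>" "\<tau> \<le> T" using \<open>T > 0\<close> by (auto simp: \<tau>_def)
  have "\<mu> * \<tau> \<le> (\<bar>\<mu>\<bar> + 1) * (1 / (\<bar>\<mu>\<bar> + 1))"
    using \<tau> by (intro mult_mono) (auto simp: \<tau>_def)
  also have "\<dots> = 1" using abs_ge_zero[of \<mu>] by simp
  finally have \<mu>\<tau>: "\<mu> * \<tau> \<le> 1" .
  have \<beta>': "norm (P (T - t)) \<le> \<beta>" and P_sa': "P (T - t) \<in> selfadjoint_ops" if "t \<in> {0..\<tau>}" for t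
    using \<beta> P_sa that \<tau> by auto
  have main: "riccati_unique_strict_solution UNIV \<tau> (yosida D A n) G T P F \<eta>\<^sub>0
      \<and> (F \<in> selfadjoint_ops \<and> Qbar\<^sub>T o\<^sub>L S\<^sub>T \<in> selfadjoint_ops \<longrightarrow>
          riccati_unique_strict_solution selfadjoint_ops \<tau> (yosida D A n) G T P F \<eta>\<^sub>0)"
    if n: "n \<ge> 1" "real n > \<omega>" for n :: nat
  proof -
    let ?L = "yosida D A n"
    have L: "renorm (?L x + real n *\<^sub>R x) \<le> (real n + c) * renorm x" for x
      using renorm_yosida[OF assms(1,3) n(2,1), of x] mult_right_mono[OF c(2)[OF n(2)] renorm_nonneg[of x]]
      by linarith
    have "\<exists>\<eta>. riccati_strict_solution UNIV \<tau> ?L G T P F \<eta>\<^sub>0 \<eta>"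
    proof (rule strict_solution_exists[where p = renorm and M = M and \<nu> = "real n" and c = c
          and \<beta> = \<beta> and r = r and \<mu> = \<mu>])
      show "renorm (?L x + real n *\<^sub>R x) \<le> (real n + c) * renorm x" for x by (rule L)
      show "continuous_on {0..T} (\<lambda>t. P t x)" for x by (rule P_cont)
      show "norm (P t) \<le> \<beta>" if "t \<in> {0..T}" for t by (rule \<beta>[OF that])
    qed (use \<tau> \<mu>\<tau> c(1) in \<open>simp_all add: norm_le_renorm renorm_le r_def \<mu>_def\<close>)
    then obtain \<eta> where \<eta>: "riccati_strict_solution UNIV \<tau> ?L G T P F \<eta>\<^sub>0 \<eta>" ..
    have unique: "\<zeta> t = \<eta> t" if "riccati_strict_solution UNIV \<tau> ?L G T P F \<eta>\<^sub>0 \<zeta>" "t \<in> {0..\<tau>}" for \<zeta> t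
      by (rule strict_solution_unique[OF \<eta> that(1) \<beta>' that(2)])
    have sub: "riccati_strict_solution UNIV \<tau> ?L G T P F \<eta>\<^sub>0 \<zeta>"
      if "riccati_strict_solution selfadjoint_ops \<tau> ?L G T P F \<eta>\<^sub>0 \<zeta>" for \<zeta>
      using that by (simp add: riccati_strict_solution_def C1s_def)
    have "riccati_strict_solution selfadjoint_ops \<tau> ?L G T P F \<eta>\<^sub>0 \<eta>"
      if "F \<in> selfadjoint_ops" "Qbar\<^sub>T o\<^sub>L S\<^sub>T \<in> selfadjoint_ops"
    proof -
      have "\<eta> t \<in> selfadjoint_ops" if "t \<in> {0..\<tau>}" for t
        by (rule strict_solution_selfadjoint[OF \<eta> G \<open>F \<in> _\<close> _ P_sa' \<beta>' that])
           (use \<open>Qbar\<^sub>T o\<^sub>L S\<^sub>T \<in> _\<close> in \<open>simp_all add: \<eta>\<^sub>0_def selfadjoint_ops_uminus\<close>)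
      then show ?thesis using \<eta> by (simp add: riccati_strict_solution_def C1s_def)
    qed
    then show ?thesis
      unfolding riccati_unique_strict_solution_def using \<eta> unique sub by blast
  qed
  show ?thesis
    using \<tau> main unfolding G_def F_def \<eta>\<^sub>0_def by blast
qed

end
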